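(* Let $n,d$ be positive integers, let $A=A_n^{dn}$, and let $\mathcal{P}$ be the set of non-crossing partitions of $\underline{n}=\{1,\dots,n\}$. Then: (a) For every $p\in\mathcal{P}$ and every $1\le k\le n$, the sets $\mathcal{L}_{p,k}$ and $\mathcal{S}_{p,k}$ are simple-minded systems of $A$-$\underline{\mathrm{mod}}$. (b) Every simple-minded system of $A$-$\underline{\mathrm{mod}}$ is equal to $\mathcal{L}_{p,k}$ or to $\mathcal{S}_{p,k}$ for some $p\in\mathcal{P}$ and some $1\le k\le n$. (c) If $d\ge 2$, then for all $p,p'\in\mathcal{P}$ and $1\le k,k'\le n$: (1) $\mathcal{L}_{p,k}\neq\mathcal{S}_{p',k'}$; (2) $\mathcal{L}_{p,k}=\mathcal{L}_{p',k'}$ if and only if $p=p'$ and $p(k)=p(k')$; (3) $\mathcal{S}_{p,k}=\mathcal{S}_{p',k'}$ if and only if the following three conditions hold: (i) $p=p'$; (ii) $k=k'$ or $\widehat{k}\cap\widehat{k'}=\emptyset$; (iii) $p_{k\vee k'}$ is a non-crossing partition, where $p_{k\vee k'}$ is the partition whose block containing $i$ is $p(k)\cup p(k')$ if $i\in p(k)\cup p(k')$ and $p(i)$ otherwise.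
   Context: $k$ is an algebraically closed field. For positive integers $n,\ell$, $A_n^\ell=kQ/I$ where $Q$ is the cyclic quiver with vertices $1,\dots,n$ and arrows $i\to i+1$ ($1\le i<n$) and $n\to 1$, and $I$ is the ideal generated by all paths of length $\ell+1$ (a self-injective Nakayama algebra; $A_n^{dn}$ is symmetric). $S_1,\dots,S_n$ are the simple modules. For $a\in\mathbb{Z}$, $\bar a\in\{1,\dots,n\}$ denotes the integer with $a\equiv\bar a\pmod n$. Every indecomposable module is uniserial, with composition factors $S_i,S_{\overline{i+1}},S_{\overline{i+2}},\dots$ from top to socle; it is projective iff its length is $\ell+1$. $M^i_{j,t}$ denotes the indecomposable module with top $S_i$, socle $S_j$, and in which $S_i$ occurs exactly $t+1$ times as a composition factor. $A$-$\underline{\mathrm{mod}}$ is the stable module category, with $\underline{\mathrm{Hom}}_A(M,N)=\mathrm{Hom}_A(M,N)$ modulo maps factoring through projective modules. A simple-minded system (sms) of $A$-$\underline{\mathrm{mod}}$ is a family $\mathcal{S}$ of indecomposable non-projective modules (up to isomorphism) such that $\underline{\mathrm{Hom}}_A(S,T)=0$ for distinct $S,T\in\mathcal{S}$, $\underline{\mathrm{Hom}}_A(S,S)\cong k$ for $S\in\mathcal{S}$, and for every indecomposable non-projective $X$ there is $S\in\mathcal{S}$ with $\underline{\mathrm{Hom}}_A(X,S)\neq0$. A partition $p$ of $\underline{n}$ is non-crossing if there are no $a<x<b<y$ with $a,b$ in one block and $x,y$ in a different block. $p(i)$ denotes the block containing $i$. For $i\in\underline{n}$, let $k_i$ be the first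 element of $p(i)$ in the sequence $\overline{i-1},\overline{i-2},\dots,\overline{i-n}=i$ (so $k_i=i$ if $p(i)=\{i\}$; equivalently $p(i)\subseteq\{i,\overline{i+1},\dots,k_i\}$), and let $\widehat{i}=\{i,\overline{i+1},\overline{i+2},\dots,k_i\}$ (the vertices of the cyclic path from $i$ to $k_i$). For $p\in\mathcal{P}$ and $1\le k\le n$ define $\mathcal{L}_{p,k}=\{M^i_{k_i,l_i}\mid i=1,\dots,n\}$ with $l_i=0$ if $\widehat{i}\cap p(k)=\emptyset$ and $l_i=d-1$ otherwise; $\mathcal{S}_{p,k}=\{M^i_{k_i,l_i}\mid i=1,\dots,n\}$ with $l_i=0$ if $\widehat{i}\cap p(k)=\emptyset$ or $i=k$, and $l_i=d-1$ otherwise. *)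

theory Defs
  imports Main "HOL-Computational_Algebra.Polynomial" "HOL-Library.Disjoint_Sets"
begin

text \<open>Vertices of the cyclic quiver are 1..n.  cyc n a is the representative in 1..n of a mod n.\<close>
definition cyc :: "nat \<Rightarrow> int \<Rightarrow> nat" where
  "cyc n a = nat ((a - 1) mod int n) + 1"

text \<open>Indecomposable modules (up to isomorphism) are uniserial; the module with top S_i and
length m is identified with the pair (i,m). It has basis e_0..e_(m-1), where e_a lies at
vertex vert n i a, and the arrow starting at vert n i a sends e_a to e_(a+1) (or 0 if a+1 = m).\<close>
definition vert :: "nat \<Rightarrow> nat \<Rightarrow> nat \<Rightarrow> nat" where
  "vert n i a = cyc n (int i + int a)"

type_synonym 'k mat = "nat \<Rightarrow> nat \<Rightarrow> 'k"

text \<open>A k-linear map M(i,m) -> M(j,m') is encoded by its matrix F, with F a c the coefficient of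
e_c in the image of e_a.  It is an A-module homomorphism iff it commutes with all vertex
idempotents e_v and all arrows alpha_v (which generate A).\<close>
definition is_hom :: "nat \<Rightarrow> nat \<times> nat \<Rightarrow> nat \<times> nat \<Rightarrow> ('k::field) mat \<Rightarrow> bool" where
  "is_hom n M N F \<longleftrightarrow> (case M of (i, m) \<Rightarrow> case N of (j, m') \<Rightarrow>
     (\<forall>a c. (m \<le> a \<or> m' \<le> c) \<longrightarrow> F a c = 0) \<and>
     (\<forall>v a c. a < m \<longrightarrow> c < m' \<longrightarrow>
        (if vert n i a = v then F a c else 0) = (if vert n j c = v then F a c else 0)) \<and>
     (\<forall>v a c. a < m \<longrightarrow> c < m' \<longrightarrow>
        (if vert n i a = v \<and> a + 1 < m then F (a + 1) c else 0)
        = (if 1 \<le> c \<and> vert n j (c - 1) = v then F a (c - 1) else 0)))"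

definition mcomp :: "nat \<Rightarrow> ('k::field) mat \<Rightarrow> 'k mat \<Rightarrow> 'k mat" where
  "mcomp mp F G = (\<lambda>a c. \<Sum>b<mp. F a b * G b c)"

text \<open>Projective indecomposables are the (j, l+1); a map factors through a projective module
iff it factors through a finite direct sum of them, i.e. is a finite sum of maps factoring
through indecomposable projectives.\<close>
definition proj_factor :: "nat \<Rightarrow> nat \<Rightarrow> nat \<times> nat \<Rightarrow> nat \<times> nat \<Rightarrow> ('k::field) mat \<Rightarrow> bool" where
  "proj_factor n l M N F \<longleftrightarrow>
     (\<exists>rs :: (nat \<times> 'k mat \<times> 'k mat) list.
        (\<forall>(j, H, G) \<in> set rs. 1 \<le> j \<and> j \<le> n \<and> is_hom n M (j, l + 1) H \<and> is_hom n (j, l + 1) N G) \<and>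
        F = (\<lambda>a c. sum_list (map (\<lambda>(j, H, G). mcomp (l + 1) H G a c) rs)))"

definition stable_hom_zero :: "('k::field) itself \<Rightarrow> nat \<Rightarrow> nat \<Rightarrow> nat \<times> nat \<Rightarrow> nat \<times> nat \<Rightarrow> bool" where
  "stable_hom_zero K n l M N \<longleftrightarrow> (\<forall>F :: 'k mat. is_hom n M N F \<longrightarrow> proj_factor n l M N F)"

definition stable_end_is_k :: "('k::field) itself \<Rightarrow> nat \<Rightarrow> nat \<Rightarrow> nat \<times> nat \<Rightarrow> bool" where
  "stable_end_is_k K n l M \<longleftrightarrow>
     (\<exists>\<phi> :: 'k mat. is_hom n M M \<phi> \<and> \<not> proj_factor n l M M \<phi> \<and>
        (\<forall>F. is_hom n M M F \<longrightarrow> (\<exists>c. proj_factor n l M M (\<lambda>a b. F a b - c * \<phi> a b))))"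

definition indec_nonproj :: "nat \<Rightarrow> nat \<Rightarrow> (nat \<times> nat) set" where
  "indec_nonproj n l = {(i, m). 1 \<le> i \<and> i \<le> n \<and> 1 \<le> m \<and> m \<le> l}"

definition sms :: "('k::field) itself \<Rightarrow> nat \<Rightarrow> nat \<Rightarrow> (nat \<times> nat) set \<Rightarrow> bool" where
  "sms K n l S \<longleftrightarrow> S \<subseteq> indec_nonproj n l \<and>
     (\<forall>X\<in>S. \<forall>Y\<in>S. X \<noteq> Y \<longrightarrow> stable_hom_zero K n l X Y) \<and>
     (\<forall>X\<in>S. stable_end_is_k K n l X) \<and>
     (\<forall>X\<in>indec_nonproj n l. \<exists>Y\<in>S. \<not> stable_hom_zero K n l X Y)"

text \<open>M^i_{j,t}: top S_i, socle S_j, S_i occurring t+1 times.\<close>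
definition Mmod :: "nat \<Rightarrow> nat \<Rightarrow> nat \<Rightarrow> nat \<Rightarrow> nat \<times> nat" where
  "Mmod n i j t = (i, THE m. 1 \<le> m \<and> vert n i (m - 1) = j \<and> card {a. a < m \<and> vert n i a = i} = t + 1)"

definition noncrossing :: "nat \<Rightarrow> nat set set \<Rightarrow> bool" where
  "noncrossing n p \<longleftrightarrow> partition_on {1..n} p \<and>
     \<not> (\<exists>B\<in>p. \<exists>B'\<in>p. B \<noteq> B' \<and> (\<exists>a x b y. a \<in> B \<and> b \<in> B \<and> x \<in> B' \<and> y \<in> B' \<and> a < x \<and> x < b \<and> b < y))"

definition block :: "nat set set \<Rightarrow> nat \<Rightarrow> nat set" where
  "block p i = (THE B. B \<in> p \<and> i \<in> B)"

definition kk :: "nat \<Rightarrow> nat set set \<Rightarrow> nat \<Rightarrow> nat" where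
  "kk n p i = cyc n (int i - int (LEAST s. 1 \<le> s \<and> cyc n (int i - int s) \<in> block p i))"

definition hat :: "nat \<Rightarrow> nat set set \<Rightarrow> nat \<Rightarrow> nat set" where
  "hat n p i = {cyc n (int i + int t) | t. t \<le> nat ((int (kk n p i) - int i) mod int n)}"

definition Lset :: "nat \<Rightarrow> nat \<Rightarrow> nat set set \<Rightarrow> nat \<Rightarrow> (nat \<times> nat) set" where
  "Lset n d p k = {Mmod n i (kk n p i) (if hat n p i \<inter> block p k = {} then 0 else d - 1) | i. i \<in> {1..n}}"

definition Sset :: "nat \<Rightarrow> nat \<Rightarrow> nat set set \<Rightarrow> nat \<Rightarrow> (nat \<times> nat) set" where
  "Sset n d p k = {Mmod n i (kk n p i) (if hat n p i \<inter> block p k = {} \<or> i = k then 0 else d - 1) | i. i \<in> {1..n}}"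

definition join_part :: "nat set set \<Rightarrow> nat \<Rightarrow> nat \<Rightarrow> nat set set" where
  "join_part p k k' = insert (block p k \<union> block p k') (p - {block p k, block p k'})"

end

(*
  Let l = d n. Lift the uniserial module with top S_i and length m to the integers x congruent to i,
  and record it by the number F x = x + m - 1 - l, which lies in [x - l, x - 1]. A nonzero stable
  map from the module at x to the module at x' exists iff F x' <= F x < x' <= x <= F x' + l for
  suitable lifts, so the simple-minded systems are exactly the n-periodic functions F on the
  integers without a pair x' < x of this shape: the predecessor functions of the non-crossing
  partitions of Z/l that are invariant under rotation by n. Generation is automatic, because the
  F-orbit of x passes through x - l.

  Such a partition of Z/l folds to a non-crossing partition p of Z/n, and it is recovered from p
  together with the position of the centre of the polygon: the gaps of p containing the centre are
  lengthened by (d - 1) n. If the centre lies in the block of k one gets the systems L, and if it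
  lies in the gap just in front of k one gets the systems S. Statement (c) says when two such
  descriptions of the centre agree.
*)

theory Submission
  imports Defs
begin

section \<open>Stable homomorphisms between uniserial modules\<close>

text \<open>As \<open>n\<close> divides \<open>l\<close>, the number \<open>F x\<close> is congruent
  to the socle vertex; this is the reason for subtracting \<open>l\<close>: it makes
  \<open>k_i\<close>, the socle, the element preceding \<open>i\<close> in its block. Arc length
  \<open>x - F x\<close> and module length add up to \<open>l + 1\<close>, so a longer arc is a
  shorter module, and lengthening a gap by \<open>(d - 1) n\<close> is the drop of
  \<open>l_i\<close> from \<open>d - 1\<close> to \<open>0\<close>. Periodic functions on the
  integers replace residues so that cyclic order becomes linear inequalities. The obstacle is that
  an arc may be longer than \<open>n\<close> and so means nothing modulo \<open>n\<close>. Once the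
  long arcs are shortened, the only information lost is which arcs were long, and that is the
  position of the centre. A centre outside all blocks lies in a region bounded by several gaps, each
  of which names it by another \<open>k\<close>: this is the ambiguity in (c)(3). Disjoint hats say
  that each of two blocks lies in the gap of the other; the merged partition is non-crossing when no
  third block separates them.\<close>

lemma int_cyc: "0 < n \<Longrightarrow> int (cyc n x) = (x - 1) mod int n + 1"
  by (simp add: cyc_def)

lemma cyc_range: "0 < n \<Longrightarrow> cyc n x \<in> {1..n}"
proof -
  assume n: "0 < n"
  then have "(x - 1) mod int n < int n" "0 \<le> (x - 1) mod int n" by auto
  then show ?thesis using int_cyc[OF n, of x] by auto
qed

lemma cyc_eq_iff: "0 < n \<Longrightarrow> cyc n x = cyc n y \<longleftrightarrow> int n dvd x - y"
proof -
  assume n: "0 < n"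
  have "cyc n x = cyc n y \<longleftrightarrow> (x - 1) mod int n = (y - 1) mod int n"
    using int_cyc[OF n, of x] int_cyc[OF n, of y] by linarith
  also have "\<dots> \<longleftrightarrow> int n dvd x - y" by (simp add: mod_eq_dvd_iff)
  finally show ?thesis .
qed

lemma cyc_of_nat: "i \<in> {1..n} \<Longrightarrow> cyc n (int i) = i"
  by (auto simp: cyc_def of_nat_diff)

lemma vert_add: "0 < n \<Longrightarrow> vert n i a = vert n j b \<Longrightarrow> vert n i (a + s) = vert n j (b + s)"
  by (simp add: vert_def cyc_eq_iff algebra_simps)

lemma vert_zero: "i \<in> {1..n} \<Longrightarrow> vert n i 0 = i"
  by (simp add: vert_def cyc_of_nat)

section \<open>Homomorphisms are determined by the image of the top basis vector\<close>

context
  fixes n i m j m' :: nat and F :: "('k::field) mat"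
  assumes hom: "is_hom n (i, m) (j, m') F"
begin

lemma hom_support: "m \<le> a \<or> m' \<le> c \<Longrightarrow> F a c = 0"
  using hom by (auto simp: is_hom_def)

lemma hom_vert: "F a c \<noteq> 0 \<Longrightarrow> vert n i a = vert n j c"
proof -
  assume F: "F a c \<noteq> 0"
  then have "a < m" "c < m'" using hom_support[of a c] by (meson not_le)+
  then have "(if vert n i a = vert n i a then F a c else 0) = (if vert n j c = vert n i a then F a c else 0)"
    using hom unfolding is_hom_def by blast
  then show ?thesis using F by (auto split: if_splits)
qed

lemma hom_arrow:
  "a < m \<Longrightarrow> c < m' \<Longrightarrow> (if vert n i a = v \<and> a + 1 < m then F (a + 1) c else 0)
        = (if 1 \<le> c \<and> vert n j (c - 1) = v then F a (c - 1) else 0)"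
  using hom unfolding is_hom_def by blast

text \<open>\<open>e_0\<close> generates the source, and commuting with the arrow at the vertex of
  \<open>e_a\<close> carries a coefficient one step down its diagonal.\<close>

lemma hom_shift: "a < m \<Longrightarrow> c < m' \<Longrightarrow> F a c = (if a \<le> c then F 0 (c - a) else 0)"
proof (induction a arbitrary: c)
  case (Suc a)
  have "F (Suc a) c = (if 1 \<le> c \<and> vert n j (c - 1) = vert n i a then F a (c - 1) else 0)"
    using hom_arrow[of a c "vert n i a"] Suc.prems by simp
  also have "\<dots> = (if 1 \<le> c then F a (c - 1) else 0)"
    using hom_vert[of a "c - 1"] by metis
  also have "\<dots> = (if Suc a \<le> c then F 0 (c - Suc a) else 0)"
    using Suc.IH[of "c - 1"] Suc.prems by auto
  finally show ?case .
qed simp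

text \<open>The arrow kills the last basis vector \<open>e_(m-1)\<close>, so it must also kill the
  image of that vector, which carries the coefficient of \<open>e_c\<close> down at position
  \<open>c + m - 1\<close>.\<close>

lemma hom_top:
  assumes "1 \<le> m" "F 0 c \<noteq> 0"
  shows "c < m'" "m' \<le> c + m" "vert n i 0 = vert n j c"
proof -
  show c: "c < m'" using hom_support[of 0 c] assms by (meson not_le)
  show "vert n i 0 = vert n j c" using hom_vert assms by blast
  show "m' \<le> c + m"
  proof (rule ccontr)
    assume "\<not> m' \<le> c + m"
    then have lt: "c + m < m'" by simp
    have "F (m - 1) (c + m - 1) = 0"
      using hom_arrow[of "m - 1" "c + m" "vert n j (c + m - 1)"] assms(1) lt by simp
    moreover have "F (m - 1) (c + m - 1) = F 0 c"
      using hom_shift[of "m - 1" "c + m - 1"] assms(1) lt by auto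
    ultimately show False using assms by simp
  qed
qed

end

definition shift_map :: "nat \<Rightarrow> nat \<Rightarrow> (nat \<Rightarrow> 'k::field) \<Rightarrow> 'k mat" where
  "shift_map m m' f = (\<lambda>a c. if a < m \<and> c < m' \<and> a \<le> c then f (c - a) else 0)"

lemma shift_map_hom:
  assumes n: "0 < n"
    and f: "\<And>c. f c \<noteq> 0 \<Longrightarrow> m' \<le> c + m \<and> vert n i 0 = vert n j c"
  shows "is_hom n (i, m) (j, m') (shift_map m m' f)"
proof -
  have v: "vert n i a = vert n j c" if "shift_map m m' f a c \<noteq> 0" for a c
  proof -
    from that have "a \<le> c" "f (c - a) \<noteq> 0" by (auto simp: shift_map_def split: if_splits)
    then show ?thesis using f[of "c - a"] vert_add[OF n, of i 0 j "c - a" a] by simp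
  qed
  have arrow: "(if vert n i a = v \<and> a + 1 < m then shift_map m m' f (a + 1) c else 0)
        = (if 1 \<le> c \<and> vert n j (c - 1) = v then shift_map m m' f a (c - 1) else 0)"
    if ac: "a < m" "c < m'" for v a c
  proof (cases "1 \<le> c \<and> a \<le> c - 1 \<and> f (c - 1 - a) \<noteq> 0")
    case True
    \<comment> \<open>Since \<open>c < m'\<close>, the bound on \<open>f\<close> shows that the
      diagonal does not run out of the source before it runs out of the target.\<close>
    then have "m' \<le> c - 1 - a + m" using f by blast
    with True ac have am: "a + 1 < m" by linarith
    have S: "shift_map m m' f a (c - 1) = f (c - 1 - a)" "shift_map m m' f (a + 1) c = f (c - 1 - a)"
      using True ac am by (auto simp: shift_map_def)
    have "vert n i a = vert n j (c - 1)" using v[of a "c - 1"] S True by simp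
    then show ?thesis using True am S by simp
  next
    case False
    then have "shift_map m m' f (a + 1) c = 0" by (auto simp: shift_map_def)
    moreover have "1 \<le> c \<Longrightarrow> shift_map m m' f a (c - 1) = 0" using False by (auto simp: shift_map_def)
    ultimately show ?thesis by simp
  qed
  show ?thesis unfolding is_hom_def prod.case
  proof (intro conjI allI impI)
    fix a c assume "m \<le> a \<or> m' \<le> c"
    then show "shift_map m m' f a c = 0" by (auto simp: shift_map_def)
  next
    fix w a c show "(if vert n i a = w then shift_map m m' f a c else 0)
        = (if vert n j c = w then shift_map m m' f a c else 0)"
      using v[of a c] by metis
  qed (rule arrow)
qed

lemma hom_eq_shift_map:
  assumes "is_hom n (i, m) (j, m') F" shows "F = shift_map m m' (F 0)"
proof (intro ext)
  fix a c show "F a c = shift_map m m' (F 0) a c"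
    using hom_shift[OF assms, of a c] hom_support[OF assms, of a c]
    by (cases "a < m \<and> c < m'") (auto simp: shift_map_def)
qed

text \<open>The projective cover of the target is \<open>(j, l + 1)\<close>, and
  \<open>e_0 \<mapsto> e_c\<close> lifts to it when \<open>m\<close> arrows kill \<open>e_c\<close>
  there, that is, when \<open>l + 1 \<le> c + m\<close>. No other projective does better: a map into
  it sends \<open>e_0\<close> to depth at least \<open>l + 1 - m\<close>, and homomorphisms never
  decrease depth.\<close>

lemma proj_factor_iff:
  fixes F :: "('k::field) mat"
  assumes hom: "is_hom n (i, m) (j, m') F" and j: "j \<in> {1..n}" and m: "1 \<le> m" and m': "m' \<le> l + 1"
  shows "proj_factor n l (i, m) (j, m') F \<longleftrightarrow> (\<forall>c. c + m \<le> l \<longrightarrow> F 0 c = 0)"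
proof
  assume "proj_factor n l (i, m) (j, m') F"
  then obtain rs :: "(nat \<times> 'k mat \<times> 'k mat) list" where
    rs: "\<forall>(j', H, G) \<in> set rs. is_hom n (i, m) (j', l + 1) H \<and> is_hom n (j', l + 1) (j, m') G"
    and F: "F = (\<lambda>a c. sum_list (map (\<lambda>(j, H, G). mcomp (l + 1) H G a c) rs))"
    unfolding proj_factor_def by fastforce
  show "\<forall>c. c + m \<le> l \<longrightarrow> F 0 c = 0"
  proof (intro allI impI)
    fix c assume c: "c + m \<le> l"
    have "mcomp (l + 1) H G 0 c = 0" if "(j', H, G) \<in> set rs" for j' H G
    proof -
      have H: "is_hom n (i, m) (j', l + 1) H" and G: "is_hom n (j', l + 1) (j, m') G"
        using rs that by auto
      have "H 0 b * G b c = 0" if "b < l + 1" for b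
      proof (cases "H 0 b = 0")
        case False
        then have "l + 1 \<le> b + m" using hom_top[OF H m] by blast
        then have "\<not> b \<le> c" using c by linarith
        then have "G b c = 0" using hom_shift[OF G, of b c] hom_support[OF G, of b c] that by (cases "c < m'") auto
        then show ?thesis by simp
      qed simp
      then show ?thesis unfolding mcomp_def by (intro sum.neutral) auto
    qed
    then have "map (\<lambda>(j, H, G). mcomp (l + 1) H G 0 c) rs = map (\<lambda>_. 0) rs" by (auto simp: map_eq_conv)
    then show "F 0 c = 0" unfolding F by (metis sum_list_0)
  qed
next
  assume z: "\<forall>c. c + m \<le> l \<longrightarrow> F 0 c = 0"
  have n: "0 < n" using j by auto
  define H where "H = shift_map m (l + 1) (F 0)"
  define G :: "'k mat" where "G = shift_map (l + 1) m' (\<lambda>c. if c = 0 then 1 else 0)"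
  have H: "is_hom n (i, m) (j, l + 1) H" unfolding H_def
  proof (rule shift_map_hom[OF n])
    fix c assume "F 0 c \<noteq> 0"
    then show "l + 1 \<le> c + m \<and> vert n i 0 = vert n j c"
      using z hom_vert[OF hom, of 0 c] by (metis Suc_eq_plus1 not_less_eq_eq)
  qed
  have G: "is_hom n (j, l + 1) (j, m') G" unfolding G_def
    by (rule shift_map_hom[OF n]) (use m' in \<open>auto split: if_splits\<close>)
  have "F a c = mcomp (l + 1) H G a c" for a c
  proof (cases "c < m'")
    case True
    have "H a b * G b c = (if b = c then H a c else 0)" if "b < l + 1" for b
      using that True by (auto simp: G_def shift_map_def)
    then have "mcomp (l + 1) H G a c = (\<Sum>b<l + 1. if b = c then H a c else 0)"
      unfolding mcomp_def by (intro sum.cong) auto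
    also have "\<dots> = H a c" using True m' by simp
    also have "\<dots> = shift_map m m' (F 0) a c" using True m' by (auto simp: H_def shift_map_def)
    also have "\<dots> = F a c" using hom_eq_shift_map[OF hom] by metis
    finally show ?thesis by simp
  next
    case False
    then show ?thesis using hom_support[OF hom, of a c] by (simp add: mcomp_def G_def shift_map_def)
  qed
  then show "proj_factor n l (i, m) (j, m') F"
    unfolding proj_factor_def using H G j by (intro exI[of _ "[(j, H, G)]"]) auto
qed

text \<open>The shift \<open>e\<^sub>0 \<mapsto> e\<^sub>c\<close> is a homomorphism \<open>X \<rightarrow> Y\<close> that does not factor through a projective.\<close>

definition hom_shift_index :: "nat \<Rightarrow> nat \<Rightarrow> nat \<times> nat \<Rightarrow> nat \<times> nat \<Rightarrow> nat \<Rightarrow> bool" where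
  "hom_shift_index n l X Y c \<longleftrightarrow> c < snd Y \<and> snd Y \<le> c + snd X \<and> c + snd X \<le> l \<and> vert n (fst Y) c = fst X"

lemma unit_shift_hom:
  assumes "i \<in> {1..n}" "hom_shift_index n l (i, m) (j, m') c"
  shows "is_hom n (i, m) (j, m') (shift_map m m' (\<lambda>b. if b = c then 1 else 0 :: 'k::field))"
  by (rule shift_map_hom) (use assms in \<open>auto simp: hom_shift_index_def vert_zero split: if_splits\<close>)

lemma stable_hom_zero_iff:
  assumes X: "X \<in> indec_nonproj n l" and Y: "Y \<in> indec_nonproj n l"
  shows "stable_hom_zero TYPE('k::field) n l X Y \<longleftrightarrow> (\<nexists>c. hom_shift_index n l X Y c)"
proof -
  obtain i m j m' where XY: "X = (i, m)" "Y = (j, m')" by (cases X, cases Y)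
  have r: "i \<in> {1..n}" "1 \<le> m" "m \<le> l" "j \<in> {1..n}" "1 \<le> m'" "m' \<le> l" "m' \<le> l + 1"
    using X Y by (auto simp: XY indec_nonproj_def)
  show ?thesis
  proof
    assume z: "stable_hom_zero TYPE('k) n l X Y"
    show "\<nexists>c. hom_shift_index n l X Y c"
    proof
      assume "\<exists>c. hom_shift_index n l X Y c"
      then obtain c where c: "hom_shift_index n l (i, m) (j, m') c" by (auto simp: XY)
      note h = unit_shift_hom[OF r(1) c, where 'k='k]
      from z h have "proj_factor n l (i, m) (j, m') (shift_map m m' (\<lambda>b. if b = c then 1 else 0 :: 'k))"
        by (auto simp: stable_hom_zero_def XY)
      then show False using proj_factor_iff[OF h r(4) r(2) r(7)] c r
        by (auto simp: hom_shift_index_def shift_map_def)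
    qed
  next
    assume z: "\<nexists>c. hom_shift_index n l X Y c"
    show "stable_hom_zero TYPE('k) n l X Y" unfolding stable_hom_zero_def XY
    proof (intro allI impI)
      fix F :: "'k mat" assume h: "is_hom n (i, m) (j, m') F"
      have "F 0 c = 0" if "c + m \<le> l" for c
        using hom_top[OF h r(2), of c] z that vert_zero[OF r(1)] by (auto simp: hom_shift_index_def XY)
      then show "proj_factor n l (i, m) (j, m') F" using proj_factor_iff[OF h r(4) r(2) r(7)] by blast
    qed
  qed
qed

text \<open>The admissible shifts form a basis of the stable endomorphisms, and the identity,
  \<open>c = 0\<close>, is always among them.\<close>

lemma stable_end_is_k_iff:
  assumes X: "X \<in> indec_nonproj n l"
  shows "stable_end_is_k TYPE('k::field) n l X \<longleftrightarrow> (\<forall>c. hom_shift_index n l X X c \<longrightarrow> c = 0)"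
proof -
  obtain i m where XY: "X = (i, m)" by (cases X)
  have r: "i \<in> {1..n}" "1 \<le> m" "m \<le> l" "m \<le> l + 1"
    using X by (auto simp: XY indec_nonproj_def)
  note pf = proj_factor_iff[OF _ r(1) r(2) r(4), where 'k='k and i=i]
  have id: "hom_shift_index n l (i, m) (i, m) 0" using r vert_zero[OF r(1)] by (simp add: hom_shift_index_def)
  have sub: "is_hom n (i, m) (i, m) (\<lambda>a b. F a b - x * G a b)"
    if "is_hom n (i, m) (i, m) F" "is_hom n (i, m) (i, m) G" for F G :: "'k mat" and x
  proof -
    have n: "0 < n" using r by auto
    have "(\<lambda>a b. F a b - x * G a b) = shift_map m m (\<lambda>c. F 0 c - x * G 0 c)"
      by (subst hom_eq_shift_map[OF that(1)], subst hom_eq_shift_map[OF that(2)])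
        (auto simp: shift_map_def fun_eq_iff)
    moreover have "is_hom n (i, m) (i, m) (shift_map m m (\<lambda>c. F 0 c - x * G 0 c))"
    proof (rule shift_map_hom[OF n])
      fix c assume "F 0 c - x * G 0 c \<noteq> 0"
      then have "F 0 c \<noteq> 0 \<or> G 0 c \<noteq> 0" by auto
      then show "m \<le> c + m \<and> vert n i 0 = vert n i c"
        using hom_vert[OF that(1), of 0 c] hom_vert[OF that(2), of 0 c] by auto
    qed
    ultimately show ?thesis by simp
  qed
  define E :: "nat \<Rightarrow> 'k mat" where "E c = shift_map m m (\<lambda>b. if b = c then 1 else 0)" for c
  have E: "is_hom n (i, m) (i, m) (E c)" if "hom_shift_index n l (i, m) (i, m) c" for c
    unfolding E_def by (rule unit_shift_hom[OF r(1) that])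
  have E0: "E c 0 b = (if b = c then 1 else 0)" if "b < m" for b c
    using that r by (auto simp: E_def shift_map_def)
  show ?thesis
  proof
    assume "stable_end_is_k TYPE('k) n l X"
    then obtain \<phi> :: "'k mat" where \<phi>: "is_hom n (i, m) (i, m) \<phi>"
      and span: "\<And>F. is_hom n (i, m) (i, m) F \<Longrightarrow> \<exists>c. proj_factor n l (i, m) (i, m) (\<lambda>a b. F a b - c * \<phi> a b)"
      by (auto simp: stable_end_is_k_def XY)
    show "\<forall>c. hom_shift_index n l X X c \<longrightarrow> c = 0"
    proof (intro allI impI, rule ccontr)
      fix c assume c: "hom_shift_index n l X X c" and c0: "c \<noteq> 0"
      note c = c[unfolded XY]
      have cm: "c < m" "c + m \<le> l" using c by (auto simp: hom_shift_index_def)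
      obtain x where "proj_factor n l (i, m) (i, m) (\<lambda>a b. E 0 a b - x * \<phi> a b)"
        using span[OF E[OF id]] by blast
      then have x: "\<forall>c. c + m \<le> l \<longrightarrow> E 0 0 c - x * \<phi> 0 c = 0" using pf[OF sub[OF E[OF id] \<phi>]] by simp
      obtain y where "proj_factor n l (i, m) (i, m) (\<lambda>a b. E c a b - y * \<phi> a b)"
        using span[OF E[OF c]] by blast
      then have y: "\<forall>b. b + m \<le> l \<longrightarrow> E c 0 b - y * \<phi> 0 b = 0" using pf[OF sub[OF E[OF c] \<phi>]] by simp
      \<comment> \<open>One \<open>\<phi>\<close> cannot span both classes: the identity forces
        \<open>\<phi> 0 c = 0\<close>, the second shift forces it to be nonzero.\<close>
      have "x * \<phi> 0 0 = 1" "x * \<phi> 0 c = 0" "y * \<phi> 0 c = 1"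
        using x[rule_format, of 0] x[rule_format, of c] y[rule_format, of c] cm E0[of 0 0] E0[of c 0] E0[of c c] c0
        by auto
      then show False by auto
    qed
  next
    assume u: "\<forall>c. hom_shift_index n l X X c \<longrightarrow> c = 0"
    show "stable_end_is_k TYPE('k) n l X" unfolding stable_end_is_k_def XY
    proof (intro exI[of _ "E 0"] conjI allI impI)
      show "is_hom n (i, m) (i, m) (E 0)" by (rule E[OF id])
      show "\<not> proj_factor n l (i, m) (i, m) (E 0)" using pf[OF E[OF id]] r E0[of 0 0] by auto
      fix F :: "'k mat" assume F: "is_hom n (i, m) (i, m) F"
      have "F 0 c - F 0 0 * E 0 0 c = 0" if "c + m \<le> l" for c
      proof (cases "c = 0")
        case True then show ?thesis using E0[of 0 0] r by simp
      next
        case False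
        then have "\<not> hom_shift_index n l (i, m) (i, m) c" using u XY by auto
        moreover have "hom_shift_index n l (i, m) (i, m) c" if "F 0 c \<noteq> 0"
          using hom_top[OF F r(2) that] \<open>c + m \<le> l\<close> vert_zero[OF r(1)]
          by (auto simp: hom_shift_index_def)
        ultimately have "F 0 c = 0" by blast
        moreover have "E 0 0 c = 0" using False by (auto simp: E_def shift_map_def)
        ultimately show ?thesis by simp
      qed
      then show "\<exists>c. proj_factor n l (i, m) (i, m) (\<lambda>a b. F a b - c * E 0 a b)"
        using pf[OF sub[OF F E[OF id]]] by blast
    qed
  qed
qed

section \<open>Simple-minded systems as predecessor functions\<close>

text \<open>For \<open>x'\<close> a lift of the top of the target and \<open>x = x' + c\<close> one
  of the source, the inequalities of \<open>hom_shift_index\<close> become the premises of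
  \<open>nc\<close>. The inequality \<open>x' < x\<close> is strict because the shift
  \<open>c = 0\<close> is the identity of a member.\<close>

locale pred_system =
  fixes n l :: int and F :: "int \<Rightarrow> int"
  assumes n_pos: "0 < n" and n_dvd_l: "n dvd l"
    and less: "F x < x" and ge: "x - l \<le> F x" and periodic: "F (x + n) = F x + n"
    and nc: "F x' \<le> F x \<Longrightarrow> F x < x' \<Longrightarrow> x' < x \<Longrightarrow> x \<le> F x' + l \<Longrightarrow> False"

lemma periodic_mult:
  fixes f :: "int \<Rightarrow> int"
  assumes "\<And>x. f (x + n) = f x + n"
  shows "f (x + j * n) = f x + j * n"
proof (induction j rule: int_induct[where k = 0])
  case (step1 i)
  then show ?case using assms[of "x + i * n"] by (simp add: algebra_simps)
next
  case (step2 i)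
  then show ?case using assms[of "x + (i - 1) * n"] by (simp add: algebra_simps)
qed simp

context pred_system
begin

lemma period_mult: "F (x + j * n) = F x + j * n"
  by (rule periodic_mult) (rule periodic)

lemma period_dvd: "n dvd y - x \<Longrightarrow> F y = F x + (y - x)"
  using period_mult[of x] by (fastforce simp: dvd_def algebra_simps)

lemma funpow_period: "(F ^^ s) (x + j * n) = (F ^^ s) x + j * n"
  by (induction s) (simp_all add: period_mult)

lemma funpow_le: "(F ^^ s) x \<le> x - int s"
proof (induction s)
  case (Suc s)
  then show ?case using less[of "(F ^^ s) x"] by simp
qed simp

lemma funpow_antimono: "s \<le> t \<Longrightarrow> (F ^^ t) x \<le> (F ^^ s) x"
proof (induction t rule: dec_induct)
  case (step t)
  then show ?case using less[of "(F ^^ t) x"] by simp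
qed simp

lemma l_pos: "0 < l" using less[of 0] ge[of 0] by linarith

text \<open>An orbit that jumped over \<open>x - l\<close> with the step \<open>z \<mapsto> F z\<close> would have its translate by
  \<open>-l\<close> trapped between \<open>F z\<close> and \<open>z\<close>, forcing \<open>F z < z - l\<close>.\<close>

lemma orbit_closes: "\<exists>s. (F ^^ s) x = x - l"
proof -
  define k where "k = (LEAST s. (F ^^ s) x \<le> x - l)"
  have ex: "(F ^^ nat l) x \<le> x - l" using funpow_le[of "nat l" x] l_pos by simp
  have k: "(F ^^ k) x \<le> x - l" unfolding k_def using ex by (rule LeastI)
  have before: "x - l < (F ^^ s) x" if "s < k" for s
    using not_less_Least[of s "\<lambda>s. (F ^^ s) x \<le> x - l"] that unfolding k_def by simp
  have "k \<noteq> 0" using k l_pos by (intro notI) simp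
  then obtain r where r: "k = Suc r" by (cases k) auto
  define z where "z = (F ^^ r) x"
  have z: "x - l < z" using before r by (simp add: z_def)
  have "(F ^^ k) x = x - l"
  proof (rule ccontr)
    assume "(F ^^ k) x \<noteq> x - l"
    then have Fz: "F z < x - l" using k r by (simp add: z_def)
    have "F z < (F ^^ s) x - l" if "s \<le> r" for s
      using that
    proof (induction s)
      case 0
      then show ?case using Fz by simp
    next
      case (Suc s)
      let ?w = "(F ^^ s) x"
      have zF: "z \<le> F ?w" using funpow_antimono[OF Suc.prems, of x] by (simp add: z_def)
      have wx: "?w \<le> x" using funpow_le[of s x] by simp
      have p: "F (?w - l) = F ?w - l" using period_dvd[of "?w - l" ?w] n_dvd_l by simp
      have "\<not> F (?w - l) \<le> F z" using nc[of "?w - l" z] Suc z zF wx p by auto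
      then show ?case using p by simp
    qed
    from this[of r] have "F z < z - l" by (simp add: z_def)
    then show False using ge[of z] by simp
  qed
  then show ?thesis by blast
qed

end

section \<open>Predecessor functions correspond to simple-minded systems\<close>

definition arc_modules :: "nat \<Rightarrow> nat \<Rightarrow> (int \<Rightarrow> int) \<Rightarrow> (nat \<times> nat) set" where
  "arc_modules n l F = (\<lambda>i. (i, nat (F (int i) + int l - int i + 1))) ` {1..n}"

lemma sms_arc_modules:
  assumes "pred_system (int n) (int l) F"
  shows "sms TYPE('k::field) n l (arc_modules n l F)"
proof -
  interpret pred_system "int n" "int l" F by fact
  have n: "0 < n" using n_pos by simp
  let ?S = "arc_modules n l F"
  have mem: "fst X \<in> {1..n} \<and> int (snd X) = F (int (fst X)) + int l - int (fst X) + 1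
      \<and> 1 \<le> snd X \<and> snd X \<le> l" if "X \<in> ?S" for X
  proof -
    obtain i where "i \<in> {1..n}" "X = (i, nat (F (int i) + int l - int i + 1))"
      using \<open>X \<in> ?S\<close> unfolding arc_modules_def by blast
    then show ?thesis using ge[of "int i"] less[of "int i"] by auto
  qed
  have sub: "?S \<subseteq> indec_nonproj n l"
    using mem by (fastforce simp: indec_nonproj_def)
  have key: "c = 0 \<and> X = Y" if XY: "X \<in> ?S" "Y \<in> ?S" and h: "hom_shift_index n l X Y c" for X Y c
  proof -
    obtain i m j m' where eq: "X = (i, m)" "Y = (j, m')" by (cases X, cases Y)
    have i: "i \<in> {1..n}" "int m = F (int i) + int l - int i + 1"
      and j: "j \<in> {1..n}" "int m' = F (int j) + int l - int j + 1"
      using mem[OF XY(1)] mem[OF XY(2)] by (simp_all add: eq)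
    have c: "c < m'" "m' \<le> c + m" "c + m \<le> l" "vert n j c = i" using h by (auto simp: hom_shift_index_def eq)
    have "int n dvd int j + int c - int i"
      using c(4) cyc_of_nat[OF i(1)] unfolding vert_def using cyc_eq_iff[OF n, of "int j + int c" "int i"] by simp
    then have "F (int j + int c) = F (int i) + (int j + int c - int i)" by (rule period_dvd)
    then have "F (int j) \<le> F (int j + int c)" "F (int j + int c) < int j" "int j + int c \<le> F (int j) + int l"
      using c(1-3) i(2) j(2) by linarith+
    then have "\<not> int j < int j + int c" using nc[of "int j" "int j + int c"] by blast
    then have "c = 0" by simp
    moreover have "i = j" using c(4) calculation vert_zero[OF j(1)] by simp
    ultimately show ?thesis using i(2) j(2) by (simp add: eq)
  qed
  have gen: "\<exists>Y\<in>?S. \<exists>c. hom_shift_index n l X Y c" if X: "X \<in> indec_nonproj n l" for X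
  proof -
    obtain i m where eq: "X = (i, m)" by (cases X)
    have i: "i \<in> {1..n}" "1 \<le> m" "m \<le> l" using X by (auto simp: eq indec_nonproj_def)
    let ?g = "int i + int m - 1 - int l"
    \<comment> \<open>The number \<open>?g\<close> is the arc value of \<open>X\<close>. The orbit
      of \<open>i\<close> is followed to the step \<open>x \<mapsto> F x\<close> that passes
      \<open>?g\<close>; the module at \<open>x\<close> then receives a map from \<open>X\<close>.
      As the orbit meets \<open>i - l\<close>, this step cannot end below \<open>i - l\<close>,
      which is the remaining inequality.\<close>
    define k where "k = (LEAST s. (F ^^ s) (int i) \<le> ?g)"
    obtain t where t: "(F ^^ t) (int i) = int i - int l" using orbit_closes by blast
    then have tg: "(F ^^ t) (int i) \<le> ?g" using i by simp
    then have k: "(F ^^ k) (int i) \<le> ?g" and kt: "k \<le> t" unfolding k_def by (auto intro: LeastI Least_le)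
    have "k \<noteq> 0" using k i by (intro notI) simp
    then obtain r where r: "k = Suc r" by (cases k) auto
    define x where "x = (F ^^ r) (int i)"
    have x: "?g < x" using not_less_Least[of r "\<lambda>s. (F ^^ s) (int i) \<le> ?g"] r unfolding k_def x_def by simp
    have Fx: "F x \<le> ?g" using k r by (simp add: x_def)
    have Fx2: "int i - int l \<le> F x" using funpow_antimono[OF kt, of "int i"] t r by (simp add: x_def)
    have xi: "x \<le> int i" using funpow_le[of r "int i"] by (simp add: x_def)
    define j where "j = cyc n x"
    define m' where "m' = nat (F x + int l - x + 1)"
    have j: "j \<in> {1..n}" unfolding j_def by (rule cyc_range[OF n])
    have jx: "int n dvd int j - x"
      using cyc_of_nat[OF j] j_def cyc_eq_iff[OF n, of "int j" x] by simp
    have "F (int j) = F x + (int j - x)" by (rule period_dvd[OF jx])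
    then have "m' = nat (F (int j) + int l - int j + 1)" by (simp add: m'_def)
    then have "(j, m') \<in> ?S" using j unfolding arc_modules_def by blast
    moreover have "hom_shift_index n l X (j, m') (nat (int i - x))"
    proof -
      have m': "int m' = F x + int l - x + 1" using ge[of x] by (simp add: m'_def)
      have "int n dvd int j + int (nat (int i - x)) - int i" using jx xi by simp
      then have "vert n j (nat (int i - x)) = i"
        using cyc_of_nat[OF i(1)] cyc_eq_iff[OF n, of "int j + int (nat (int i - x))" "int i"]
        unfolding vert_def by simp
      then show ?thesis using m' xi x Fx Fx2 by (auto simp: hom_shift_index_def eq)
    qed
    ultimately show ?thesis by blast
  qed
  show ?thesis unfolding sms_def
  proof (intro conjI ballI impI)
    fix X Y assume "X \<in> ?S" "Y \<in> ?S" "X \<noteq> Y"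
    then show "stable_hom_zero TYPE('k) n l X Y"
      using stable_hom_zero_iff[of X n l Y, where 'k='k] sub key by blast
  next
    fix X assume "X \<in> ?S"
    then show "stable_end_is_k TYPE('k) n l X" 
      using stable_end_is_k_iff[of X n l, where 'k='k] sub key by blast
  next
    fix X assume X: "X \<in> indec_nonproj n l"
    then show "\<exists>Y\<in>?S. \<not> stable_hom_zero TYPE('k) n l X Y"
      using gen[OF X] stable_hom_zero_iff[OF X, where 'k='k] sub by blast
  qed (rule sub)
qed

text \<open>Generation gives at least one member for each top and orthogonality at most one, so the
  lengths define a function of the top.\<close>

lemma sms_imp_pred_system:
  assumes sms: "sms TYPE('k::field) n l S" and n: "0 < n" and l: "0 < l" and dvd: "n dvd l"
  obtains F where "pred_system (int n) (int l) F" "S = arc_modules n l F"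
proof -
  have sub: "S \<subseteq> indec_nonproj n l" using sms by (simp add: sms_def)
  have orth: "X = Y \<and> c = 0" if "X \<in> S" "Y \<in> S" "hom_shift_index n l X Y c" for X Y c
  proof -
    have "X \<in> indec_nonproj n l" "Y \<in> indec_nonproj n l" using that sub by auto
    then have z: "X = Y" using sms that stable_hom_zero_iff[of X n l Y, where 'k='k] unfolding sms_def by blast
    have "stable_end_is_k TYPE('k) n l X" using sms that unfolding sms_def by blast
    then show ?thesis
      using stable_end_is_k_iff[OF \<open>X \<in> indec_nonproj n l\<close>, where 'k='k] that z by blast
  qed
  have gen: "\<exists>Y\<in>S. \<exists>c. hom_shift_index n l X Y c" if X: "X \<in> indec_nonproj n l" for X
  proof -
    obtain Y where Y: "Y \<in> S" "\<not> stable_hom_zero TYPE('k) n l X Y" using sms X unfolding sms_def by blast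
    then show ?thesis using stable_hom_zero_iff[OF X, of Y, where 'k='k] sub by blast
  qed
  have ex: "\<exists>m. (i, m) \<in> S" if i: "i \<in> {1..n}" for i
  proof -
    \<comment> \<open>The longest non-projective module with top \<open>i\<close> is tested:
      \<open>c + l \<le> l\<close> leaves only \<open>c = 0\<close>, so its target has the same
      top.\<close>
    have "(i, l) \<in> indec_nonproj n l" using i l by (auto simp: indec_nonproj_def)
    then obtain j m c where jm: "(j, m) \<in> S" and h: "hom_shift_index n l (i, l) (j, m) c" using gen by fastforce
    have j: "j \<in> {1..n}" using jm sub by (auto simp: indec_nonproj_def)
    from h have "c = 0" "vert n j c = i" by (auto simp: hom_shift_index_def)
    then show ?thesis using jm vert_zero[OF j] by auto
  qed
  have uniq: "m = m'" if S: "(i, m) \<in> S" "(i, m') \<in> S" for i m m'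
  proof -
    have i: "i \<in> {1..n}" "1 \<le> m" "m \<le> l" "1 \<le> m'" "m' \<le> l" using S sub by (auto simp: indec_nonproj_def)
    \<comment> \<open>Of two modules with the same top, the longer one maps onto the shorter one,
      and this map is stably nonzero.\<close>
    have "hom_shift_index n l (i, m) (i, m') 0 \<or> hom_shift_index n l (i, m') (i, m) 0"
      using i vert_zero[OF i(1)] by (auto simp: hom_shift_index_def)
    then show ?thesis using orth S by (metis snd_conv)
  qed
  define len where "len i = (SOME m. (i, m) \<in> S)" for i
  have len: "(i, len i) \<in> S" if "i \<in> {1..n}" for i
    unfolding len_def using ex[OF that] by (rule someI_ex)
  have bounds: "1 \<le> len i" "len i \<le> l" if "i \<in> {1..n}" for i
    using len[OF that] sub by (auto simp: indec_nonproj_def)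
  define F where "F x = x + int (len (cyc n x)) - int l - 1" for x
  have "pred_system (int n) (int l) F"
  proof
    show "0 < int n" "int n dvd int l" using n dvd by auto
    fix x
    show "F x < x" "x - int l \<le> F x" using bounds[OF cyc_range[OF n, of x]] by (auto simp: F_def)
    show "F (x + int n) = F x + int n" using cyc_eq_iff[OF n, of "x + int n" x] by (simp add: F_def)
  next
    fix x' x assume a: "F x' \<le> F x" "F x < x'" "x' < x" "x \<le> F x' + int l"
    let ?i = "cyc n x" and ?j = "cyc n x'" and ?c = "nat (x - x')"
    have r: "?i \<in> {1..n}" "?j \<in> {1..n}" by (rule cyc_range[OF n])+
    have "int n dvd int ?j - x'"
      using cyc_of_nat[OF r(2)] cyc_eq_iff[OF n, of "int ?j" x'] by simp
    then have "vert n ?j ?c = ?i"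
      unfolding vert_def cyc_eq_iff[OF n] using a by (simp add: algebra_simps)
    then have "hom_shift_index n l (?i, len ?i) (?j, len ?j) ?c"
      using a by (auto simp: hom_shift_index_def F_def)
    then have "?c = 0" using orth len r by blast
    then show False using a by simp
  qed
  moreover have "S = arc_modules n l F"
  proof -
    have "S = (\<lambda>i. (i, len i)) ` {1..n}"
    proof (intro set_eqI iffI)
      fix X assume X: "X \<in> S"
      then have "fst X \<in> {1..n}" using sub by (auto simp: indec_nonproj_def)
      then show "X \<in> (\<lambda>i. (i, len i)) ` {1..n}"
        using uniq[of "fst X" "snd X" "len (fst X)"] len X by (intro image_eqI[of _ _ "fst X"]) (auto simp: prod_eq_iff)
    qed (use len in auto)
    also have "\<dots> = arc_modules n l F"
      unfolding arc_modules_def by (intro image_cong) (simp_all add: F_def cyc_of_nat)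
    finally show ?thesis .
  qed
  ultimately show ?thesis by (rule that)
qed

lemma arc_modules_eq_iff:
  assumes F: "pred_system (int n) (int l) F" and G: "pred_system (int n) (int l) G"
  shows "arc_modules n l F = arc_modules n l G \<longleftrightarrow> F = G"
proof
  assume eq: "arc_modules n l F = arc_modules n l G"
  interpret F: pred_system "int n" "int l" F by fact
  interpret G: pred_system "int n" "int l" G by fact
  have n: "0 < n" using F.n_pos by simp
  show "F = G"
  proof
    fix x
    let ?i = "cyc n x"
    have i: "?i \<in> {1..n}" by (rule cyc_range[OF n])
    have d: "int n dvd x - int ?i"
      using cyc_of_nat[OF i] cyc_eq_iff[OF n, of x "int ?i"] by simp
    have "(?i, nat (F (int ?i) + int l - int ?i + 1)) \<in> arc_modules n l G"
      unfolding eq[symmetric] unfolding arc_modules_def using i by blast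
    then have "nat (F (int ?i) + int l - int ?i + 1) = nat (G (int ?i) + int l - int ?i + 1)"
      unfolding arc_modules_def by auto
    then have "F (int ?i) = G (int ?i)" using F.ge[of "int ?i"] G.ge[of "int ?i"] by simp
    then show "F x = G x" using F.period_dvd[OF d] G.period_dvd[OF d] by simp
  qed
qed simp

section \<open>Rotation-invariant covers of a non-crossing partition\<close>

lemma residue_in_interval:
  fixes n :: int assumes "0 < n"
  obtains z where "a < z" "z \<le> a + n" "n dvd z - k"
proof
  let ?z = "a + 1 + (k - a - 1) mod n"
  show "a < ?z" "?z \<le> a + n" using assms pos_mod_sign[of n "k - a - 1"] pos_mod_bound[of n "k - a - 1"] by linarith+
  have "(k - a - 1) - (k - a - 1) mod n = n * ((k - a - 1) div n)" by (rule minus_mod_eq_mult_div)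
  then have "?z - k = n * (- ((k - a - 1) div n))" by (simp add: algebra_simps)
  then show "n dvd ?z - k" by simp
qed

text \<open>A non-crossing partition of the residues modulo \<open>n\<close>, unrolled to the
  integers. Crossing is tested in every window of length \<open>n\<close>, which makes the condition
  invariant under rotation.\<close>

locale noncrossing_rel =
  fixes n :: int and R :: "int \<Rightarrow> int \<Rightarrow> bool"
  assumes n_pos: "0 < n"
    and refl: "R x x" and sym: "R x y \<Longrightarrow> R y x" and trans: "R x y \<Longrightarrow> R y z \<Longrightarrow> R x z"
    and period: "R x (x + n)"
    and noncrossing: "a < x \<Longrightarrow> x < b \<Longrightarrow> b < y \<Longrightarrow> y < a + n \<Longrightarrow> R a b \<Longrightarrow> R x y \<Longrightarrow> R a x"
begin

text \<open>For a singleton class modulo \<open>n\<close> this is \<open>x - n\<close>.\<close>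

definition prev :: "int \<Rightarrow> int" where
  "prev x = x - int (LEAST s. 1 \<le> s \<and> R x (x - int s))"

definition gap :: "int \<Rightarrow> int \<Rightarrow> bool" where
  "gap x k \<longleftrightarrow> (\<exists>z. prev x < z \<and> z < x \<and> R z k)"

definition wrap :: "bool \<Rightarrow> int \<Rightarrow> int \<Rightarrow> bool" where
  "wrap f k x \<longleftrightarrow> gap x k \<or> (f \<and> n dvd x - k)"

text \<open>The predecessor function of the \<open>n\<close>-periodic non-crossing partition of \<open>\<int>/dn\<close> lying over
  \<open>R\<close>, where the centre of the polygon is put into the block of \<open>k\<close> (\<open>f\<close> false) or just in front
  of \<open>k\<close> (\<open>f\<close> true). Exactly the gaps containing the centre become longer.\<close>

definition cover :: "int \<Rightarrow> bool \<Rightarrow> int \<Rightarrow> int \<Rightarrow> int" where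
  "cover d f k x = prev x - (if wrap f k x then (d - 1) * n else 0)"

lemma rel_mult: "R x (x + j * n)"
proof (induction j rule: int_induct[where k = 0])
  case base
  then show ?case by (simp add: refl)
next
  case (step1 i)
  then show ?case using trans[OF _ period[of "x + i * n"], of x] by (simp add: algebra_simps)
next
  case (step2 i)
  then show ?case using trans[OF _ sym[OF period[of "x + (i - 1) * n"]], of x] by (simp add: algebra_simps)
qed

lemma rel_dvd: "n dvd y - x \<Longrightarrow> R x y"
  using rel_mult[of x "(y - x) div n"] by simp

lemma prev_least:
  shows prev_less: "prev x < x" and prev_rel: "R x (prev x)" and prev_ge: "x - n \<le> prev x"
    and prev_gap: "prev x < z \<Longrightarrow> z < x \<Longrightarrow> \<not> R x z"
proof -
  let ?P = "\<lambda>s. 1 \<le> s \<and> R x (x - int s)"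
  have ex: "?P (nat n)" using n_pos sym[OF period[of "x - n"]] by simp
  have L: "?P (LEAST s. ?P s)" using ex by (rule LeastI)
  then show "prev x < x" "R x (prev x)" by (auto simp: prev_def)
  have "(LEAST s. ?P s) \<le> nat n" using ex by (rule Least_le)
  then show "x - n \<le> prev x" using n_pos by (simp add: prev_def)
  assume z: "prev x < z" "z < x"
  then have "nat (x - z) < (LEAST s. ?P s)" by (simp add: prev_def)
  then have "\<not> ?P (nat (x - z))" by (rule not_less_Least)
  then show "\<not> R x z" using z by simp
qed

lemma prev_greatest: "R x y \<Longrightarrow> y < x \<Longrightarrow> y \<le> prev x"
  using prev_gap[of x y] by force

lemma prev_eqI: "y < x \<Longrightarrow> R x y \<Longrightarrow> (\<And>z. y < z \<Longrightarrow> z < x \<Longrightarrow> \<not> R x z) \<Longrightarrow> prev x = y"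
  by (metis linorder_neqE prev_gap prev_less prev_rel)

lemma prev_mult: "prev (x + j * n) = prev x + j * n"
proof (rule prev_eqI)
  show "prev x + j * n < x + j * n" using prev_less by simp
  show "R (x + j * n) (prev x + j * n)" using rel_mult prev_rel sym trans by meson
  fix z assume z: "prev x + j * n < z" "z < x + j * n"
  then have "\<not> R x (z - j * n)" by (intro prev_gap) auto
  moreover have "R x (x + j * n)" "R z (z - j * n)" using rel_mult[of z "- j"] rel_mult by auto
  ultimately show "\<not> R (x + j * n) z" using trans by blast
qed

lemma prev_dvd: "n dvd y - x \<Longrightarrow> prev y = prev x + (y - x)"
  using prev_mult[of x] by (fastforce simp: dvd_def algebra_simps)

lemma prev_eq_prev: "prev x = prev y \<Longrightarrow> R x y"
  using prev_rel sym trans by metis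

text \<open>The chords from \<open>prev x'\<close> to \<open>x'\<close> and from
  \<open>prev x\<close> to \<open>x\<close> would cross. If one of the outer inequalities is an
  equality, then \<open>x\<close> and \<open>x'\<close> are related although \<open>x'\<close> lies
  in the gap of \<open>x\<close>.\<close>

lemma not_crossing_prev:
  assumes "prev x' \<le> prev x" "prev x < x'" "x' < x" "x \<le> prev x' + n"
  shows False
proof -
  have nR: "\<not> R x x'" using prev_gap[of x x'] assms by simp
  have neq: "prev x' \<noteq> prev x" using nR prev_eq_prev by metis
  have "R x' (prev x' + n)" using prev_rel period trans by blast
  then have "x \<noteq> prev x' + n" using nR sym by blast
  then have "R (prev x') (prev x)"
    using noncrossing[of "prev x'" "prev x" x' x] assms neq sym[OF prev_rel[of x]] sym[OF prev_rel[of x']]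
    by linarith
  then show False using nR prev_rel sym trans by metis
qed

section \<open>Position of a class relative to the gaps\<close>

lemma gap_dvd: assumes "n dvd y - x" shows "gap y k \<longleftrightarrow> gap x k"
proof -
  have "gap y k" if g: "gap x k" and d: "n dvd y - x" for x y
  proof -
    obtain z where z: "prev x < z" "z < x" "R z k" using g by (auto simp: gap_def)
    have "R (z + (y - x)) z" using d by (intro sym[OF rel_dvd]) simp
    then have "R (z + (y - x)) k" using z(3) by (rule trans)
    then show ?thesis unfolding gap_def using z prev_dvd[OF d] by (intro exI[of _ "z + (y - x)"]) auto
  qed
  from this[of x y] this[of y x] assms show ?thesis by (metis dvd_diff_commute)
qed

lemma gap_rel: "R k k' \<Longrightarrow> gap x k \<longleftrightarrow> gap x k'"
  unfolding gap_def using trans sym by meson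

lemma gap_not_rel: "gap x k \<Longrightarrow> \<not> R x k"
  unfolding gap_def using prev_gap trans sym by metis

lemma wrap_dvd: "n dvd y - x \<Longrightarrow> wrap f k y \<longleftrightarrow> wrap f k x"
  unfolding wrap_def using gap_dvd[of y x k] dvd_add_right_iff[of n "y - x" "x - k"] by simp

lemma gap_nested:
  assumes "prev x \<le> prev u" "u < x" "wrap f k u"
  shows "gap x k"
proof (cases "gap u k")
  case True
  then obtain z where "prev u < z" "z < u" "R z k" by (auto simp: gap_def)
  then show ?thesis unfolding gap_def using assms by (intro exI[of _ z]) auto
next
  case False
  then have "R u k" using assms(3) rel_dvd sym by (auto simp: wrap_def)
  then show ?thesis unfolding gap_def using assms prev_less[of u] by (intro exI[of _ u]) auto
qed

text \<open>The gap of \<open>x\<close> contains the interval from \<open>x'\<close> to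
  \<open>prev x' + n\<close>, which together with the gap of \<open>x'\<close> makes up a full
  period.\<close>

lemma gap_cover:
  assumes "prev x < x'" "prev x' + n < x"
  shows "gap x k \<or> gap x' k"
proof -
  obtain z where z: "prev x' < z" "z \<le> prev x' + n" "n dvd z - k"
    by (rule residue_in_interval[OF n_pos])
  have "R z k" using rel_dvd[OF z(3)] by (rule sym)
  then show ?thesis unfolding gap_def using z assms by (cases "z < x'") (auto intro: exI[of _ z])
qed

lemma gap_separates:
  assumes "prev x < z'" "z' < x" "x \<le> z" "z \<le> prev x + n"
  shows "\<not> R z z'"
proof
  assume R: "R z z'"
  have nR: "\<not> R x z'" using prev_gap assms by blast
  have "R x (prev x + n)" using prev_rel period trans by blast
  then have "z \<noteq> x" "z \<noteq> prev x + n" using nR R trans by blast+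
  then have "R (prev x) z'"
    using noncrossing[of "prev x" z' x z] assms sym[OF R] sym[OF prev_rel[of x]] by linarith
  then show False using nR prev_rel trans by blast
qed

text \<open>By \<open>gap_separates\<close> a class lies, modulo \<open>n\<close>, either wholly in
  the gap of \<open>x\<close> or wholly in the complementary interval, the hat of
  \<open>x\<close>.\<close>

lemma gap_iff: "gap x k \<longleftrightarrow> (\<forall>z. R z k \<longrightarrow> x \<le> z \<longrightarrow> \<not> z \<le> prev x + n)"
proof
  assume "gap x k"
  then obtain z' where z': "prev x < z'" "z' < x" "R z' k" by (auto simp: gap_def)
  then show "\<forall>z. R z k \<longrightarrow> x \<le> z \<longrightarrow> \<not> z \<le> prev x + n"
    using gap_separates[OF z'(1,2)] sym trans by blast
next
  assume a: "\<forall>z. R z k \<longrightarrow> x \<le> z \<longrightarrow> \<not> z \<le> prev x + n"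
  obtain z where z: "prev x < z" "z \<le> prev x + n" "n dvd z - k"
    by (rule residue_in_interval[OF n_pos])
  have "R z k" using rel_dvd[OF z(3)] by (rule sym)
  then show "gap x k" unfolding gap_def using a z by (intro exI[of _ z]) auto
qed

text \<open>The gaps of \<open>x'\<close> and \<open>x\<close> are disjoint within one period, so
  the centre cannot lie behind both chords.\<close>

lemma no_disjoint_wraps:
  assumes x: "x' \<le> prev x" "x \<le> prev x' + n" and w: "wrap f k x'" "wrap f k x"
  shows False
proof -
  note l = prev_less[of x] prev_less[of x']
  consider (1) z where "gap x' k" "R z k" "prev x < z" "z \<le> x"
    | (2) "\<not> gap x' k" "f" "n dvd x' - k" "gap x k"
    | (3) "\<not> gap x' k" "f" "n dvd x' - k" "n dvd x - k"
  proof -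
    have "\<exists>z. R z k \<and> prev x < z \<and> z \<le> x"
    proof (cases "gap x k")
      case True
      then show ?thesis by (auto simp: gap_def intro: less_imp_le)
    next
      case False
      then have "R x k" using w(2) rel_dvd[of x k] sym by (auto simp: wrap_def)
      then show ?thesis using l by auto
    qed
    then show ?thesis using that w unfolding wrap_def by blast
  qed
  then show False
  proof cases
    case (1 z)
    then obtain z' where z': "prev x' < z'" "z' < x'" "R z' k" by (auto simp: gap_def)
    moreover have "R z z'" using 1(2) sym[OF z'(3)] by (rule trans)
    ultimately show False using gap_separates[of x' z' z] 1 x by linarith
  next
    case 2
    then obtain z where z: "prev x < z" "z < x" "R z k" by (auto simp: gap_def)
    then have Rz: "R x' z" using rel_dvd[OF 2(3)] sym trans by blast
    have nR: "\<not> R x z" using prev_gap z by blast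
    then have "prev x \<noteq> x'" using Rz prev_rel trans by blast
    then have "R x' (prev x)"
      using noncrossing[of x' "prev x" z x] Rz x z l sym[OF prev_rel[of x]] by linarith
    then show False using nR Rz prev_rel sym trans by meson
  next
    case 3
    then have "n dvd x - x'" using dvd_diff[of n "x - k" "x' - k"] by simp
    then have "n \<le> x - x'" using x l by (intro zdvd_imp_le) auto
    then show False using x l by linarith
  qed
qed

text \<open>A violation of \<open>nc\<close> is either a crossing in \<open>R\<close> or an
  impossible position of the centre: in neither of two gaps that cover a period, in the inner but
  not the outer of two nested gaps, or in both of two disjoint gaps.\<close>

lemma pred_system_cover:
  assumes d: "1 \<le> d"
  shows "pred_system n (d * n) (cover d f k)"
proof
  define e where "e = (d - 1) * n"
  have e: "0 \<le> e" "d * n = e + n" "n dvd e" using d n_pos by (auto simp: e_def algebra_simps)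
  note cov = cover_def[of d f k, folded e_def]
  show "0 < n" "n dvd d * n" using n_pos by auto
  fix x
  show "cover d f k x < x" "x - d * n \<le> cover d f k x"
    using prev_less[of x] prev_ge[of x] e by (auto simp: cov)
  show "cover d f k (x + n) = cover d f k x + n"
    using prev_mult[of x 1] wrap_dvd[of "x + n" x f k] by (simp add: cov)
next
  define e where "e = (d - 1) * n"
  have e: "0 \<le> e" "d * n = e + n" "n dvd e" using d n_pos by (auto simp: e_def algebra_simps)
  note cov = cover_def[of d f k, folded e_def]
  fix x' x
  assume a: "cover d f k x' \<le> cover d f k x" "cover d f k x < x'" "x' < x" "x \<le> cover d f k x' + d * n"
  note l = prev_less[of x] prev_less[of x'] prev_ge[of x] prev_ge[of x']
  show False
  proof (cases "wrap f k x"; cases "wrap f k x'")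
    assume w: "\<not> wrap f k x" "\<not> wrap f k x'"
    then have "\<not> gap x k" "\<not> gap x' k" by (auto simp: wrap_def)
    then have "\<not> prev x' + n < x" using gap_cover[of x x' k] a w by (auto simp: cov)
    then show False using not_crossing_prev[of x' x] a w by (auto simp: cov)
  next
    assume w: "wrap f k x" "\<not> wrap f k x'"
    \<comment> \<open>After translation by \<open>-e\<close> the value \<open>cover d f k x\<close>
      is the plain predecessor of \<open>x - e\<close>, so the comparison with \<open>x'\<close>
      takes place in \<open>R\<close>.\<close>
    have pu: "prev (x - e) = prev x - e" "wrap f k (x - e)"
      using prev_dvd[of "x - e" x] wrap_dvd[of "x - e" x] w e by auto
    have "\<not> x' < x - e" using not_crossing_prev[of x' "x - e"] a w e pu by (auto simp: cov)
    moreover have "x' \<noteq> x - e" using pu w by blast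
    ultimately have "gap x' k" using gap_nested[of x' "x - e"] a w pu by (auto simp: cov)
    then show False using w by (simp add: wrap_def)
  next
    assume w: "\<not> wrap f k x" "wrap f k x'"
    have "\<not> prev x' \<le> prev x" using not_crossing_prev[of x' x] a w e by (auto simp: cov)
    then have "gap x k" using gap_nested[of x x'] a w by auto
    then show False using w by (simp add: wrap_def)
  next
    assume w: "wrap f k x" "wrap f k x'"
    have "\<not> prev x < x'" using not_crossing_prev[of x' x] a w e by (auto simp: cov)
    then show False using no_disjoint_wraps[of x' x] a w e by (auto simp: cov)
  qed
qed

end

section \<open>Every predecessor function is a cover\<close>

definition orbit_rel :: "int \<Rightarrow> (int \<Rightarrow> int) \<Rightarrow> int \<Rightarrow> int \<Rightarrow> bool" where
  "orbit_rel n q x y \<longleftrightarrow> (\<exists>s t j. (q ^^ s) x = (q ^^ t) y + j * n)"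

context pred_system
begin

text \<open>If \<open>F x = F x'\<close> with \<open>x' < x\<close>, the other premises of
  \<open>nc\<close> follow from \<open>less\<close> and \<open>ge\<close>.\<close>

lemma inj: "inj F"
proof (rule injI)
  have no: "x \<le> x'" if "F x = F x'" for x x'
    using nc[of x' x] that less[of x'] ge[of x] by fastforce
  fix x y assume "F x = F y"
  then show "x = y" using no[of x y] no[of y x] by simp
qed

lemma funpow_cancel: "(F ^^ s) x = (F ^^ t) y \<Longrightarrow> s \<le> t \<Longrightarrow> x = (F ^^ (t - s)) y"
  using funpow_add[of s "t - s" F] inj_fn[OF inj, of s] by (auto dest: injD)

text \<open>Extracts the single step of an orbit that passes \<open>x\<close>: crossing arguments
  need one arc, while related points give only a whole orbit segment.\<close>

lemma orbit_straddle:
  assumes "(F ^^ s) b = a" "a \<le> x" "x < b"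
  obtains r where "F ((F ^^ r) b) \<le> x" "x < (F ^^ r) b" "a \<le> F ((F ^^ r) b)" "(F ^^ r) b \<le> b"
proof -
  define k where "k = (LEAST r. (F ^^ r) b \<le> x)"
  have k: "(F ^^ k) b \<le> x" and ks: "k \<le> s" unfolding k_def using assms by (auto intro: LeastI Least_le)
  have "k \<noteq> 0" using k assms by (intro notI) simp
  then obtain r where r: "k = Suc r" by (cases k) auto
  have "x < (F ^^ r) b" using not_less_Least[of r "\<lambda>r. (F ^^ r) b \<le> x"] r unfolding k_def by simp
  moreover have "a \<le> F ((F ^^ r) b)" using funpow_antimono[OF ks, of b] r assms by simp
  moreover have "(F ^^ r) b \<le> b" using funpow_le[of r b] by simp
  ultimately show ?thesis using that[of r] k r by simp
qed

end

section \<open>The case \<open>l = n\<close>: orbits as classes of a non-crossing partition\<close>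

locale closed_pred_system = pred_system n n q for n :: int and q :: "int \<Rightarrow> int"
begin

lemma orbit_reaches: "\<exists>s. (q ^^ s) (x + int J * n) = x"
proof (induction J)
  case 0
  show ?case by (rule exI[of _ 0]) simp
next
  case (Suc J)
  then obtain s where s: "(q ^^ s) (x + int J * n) = x" by blast
  obtain t where "(q ^^ t) (x + int J * n + n) = x + int J * n"
    using orbit_closes[of "x + int J * n + n"] by auto
  then have "(q ^^ (s + t)) (x + int (Suc J) * n) = x" using s by (simp add: funpow_add algebra_simps)
  then show ?case by blast
qed

text \<open>For \<open>l = n\<close> an orbit passes through all lower translates by
  \<open>n\<close> of its points, so the translation in \<open>orbit_rel\<close> is absorbed by
  starting high enough; injectivity cancels common iterates.\<close>

lemma common_orbit:
  assumes "orbit_rel n q x y"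
  obtains X a b where "(q ^^ a) X = x" "(q ^^ b) X = y"
proof -
  have *: "\<exists>X a b. (q ^^ a) X = x \<and> (q ^^ b) X = y" if c: "(q ^^ c) x = y + j * n" for x y c j
  proof -
    obtain a where a: "(q ^^ a) (x + int (nat \<bar>j\<bar>) * n) = x" using orbit_reaches by blast
    \<comment> \<open>The common starting point \<open>x + \<bar>j\<bar> n\<close> exceeds both
      \<open>x\<close> and \<open>x - j n\<close> by a non-negative multiple of
      \<open>n\<close>.\<close>
    have "x - j * n + int (nat (\<bar>j\<bar> + j)) * n = x + int (nat \<bar>j\<bar>) * n" by (simp add: distrib_right)
    from orbit_reaches[of "x - j * n" "nat (\<bar>j\<bar> + j)", unfolded this]
    obtain b where b: "(q ^^ b) (x + int (nat \<bar>j\<bar>) * n) = x - j * n" by blast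
    have "(q ^^ c) (x - j * n) = y" using c funpow_period[of c x "- j"] by simp
    then have "(q ^^ (c + b)) (x + int (nat \<bar>j\<bar>) * n) = y" using b by (simp add: funpow_add)
    then show ?thesis using a by blast
  qed
  obtain s t j where "(q ^^ s) x = (q ^^ t) y + j * n" using assms by (auto simp: orbit_rel_def)
  then have st: "(q ^^ s) x = (q ^^ t) (y + j * n)" by (simp add: funpow_period)
  have "\<exists>X a b. (q ^^ a) X = x \<and> (q ^^ b) X = y"
  proof (cases "s \<le> t")
    case True
    have "(q ^^ (t - s)) y + j * n = x" using funpow_cancel[OF st True] by (simp add: funpow_period)
    then have "(q ^^ (t - s)) y = x + (- j) * n" by simp
    from *[OF this] show ?thesis by blast
  next
    case False
    have "y + j * n = (q ^^ (s - t)) x" using funpow_cancel[OF st[symmetric]] False by simp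
    from *[OF this[symmetric]] show ?thesis .
  qed
  then show ?thesis using that by blast
qed

lemma orbit_rel_less:
  assumes "orbit_rel n q x y" "y < x"
  obtains s where "1 \<le> s" "(q ^^ s) x = y"
proof -
  obtain X a b where X: "(q ^^ a) X = x" "(q ^^ b) X = y" using assms(1) by (rule common_orbit)
  have ab: "a < b" using funpow_antimono[of b a X] X assms(2) by force
  have "(q ^^ (b - a)) x = (q ^^ (b - a + a)) X" by (simp add: funpow_add X)
  then have "(q ^^ (b - a)) x = y" using ab X by simp
  then show ?thesis using that[of "b - a"] ab by simp
qed

lemma orbit_rel_trans: "orbit_rel n q x y \<Longrightarrow> orbit_rel n q y z \<Longrightarrow> orbit_rel n q x z"
proof -
  assume "orbit_rel n q x y" "orbit_rel n q y z"
  then obtain s t j u v j' where 1: "(q ^^ s) x = (q ^^ t) y + j * n" and 2: "(q ^^ u) y = (q ^^ v) z + j' * n"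
    by (auto simp: orbit_rel_def)
  have "(q ^^ (u + s)) x = (q ^^ (u + t)) y + j * n" by (simp add: funpow_add 1 funpow_period)
  also have "(q ^^ (u + t)) y = (q ^^ (t + u)) y" by (simp add: add.commute)
  also have "\<dots> = (q ^^ (t + v)) z + j' * n" by (simp add: funpow_add 2 funpow_period)
  finally have "(q ^^ (u + s)) x = (q ^^ (t + v)) z + (j' + j) * n" by (simp add: algebra_simps)
  then show ?thesis unfolding orbit_rel_def by blast
qed

lemma orbit_rel_sym: "orbit_rel n q x y \<Longrightarrow> orbit_rel n q y x"
proof -
  assume "orbit_rel n q x y"
  then obtain s t j where "(q ^^ s) x = (q ^^ t) y + j * n" by (auto simp: orbit_rel_def)
  then have "(q ^^ t) y = (q ^^ s) x + (- j) * n" by simp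
  then show ?thesis unfolding orbit_rel_def by blast
qed

lemma orbit_rel_funpow: "orbit_rel n q x ((q ^^ r) x)"
  unfolding orbit_rel_def by (intro exI[of _ r] exI[of _ 0]) simp

lemma noncrossing_orbit_rel: "noncrossing_rel n (orbit_rel n q)"
proof
  show "0 < n" by (rule n_pos)
  show "orbit_rel n q x x" for x using orbit_rel_funpow[of x 0] by simp
  show "orbit_rel n q x (x + n)" for x
    unfolding orbit_rel_def by (intro exI[of _ 0] exI[of _ "-1"]) simp
  fix a x b y
  assume o: "a < x" "x < b" "b < y" "y < a + n" and R: "orbit_rel n q a b" "orbit_rel n q x y"
  show "orbit_rel n q a x"
  proof (rule ccontr)
    assume nR: "\<not> orbit_rel n q a x"
    obtain s where s: "(q ^^ s) b = a" using orbit_rel_less[OF orbit_rel_sym[OF R(1)]] o by auto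
    obtain t where t: "(q ^^ t) y = x" using orbit_rel_less[OF orbit_rel_sym[OF R(2)]] o by auto
    \<comment> \<open>The orbit from \<open>b\<close> to \<open>a\<close> has a step from some
      \<open>?u\<close> across \<open>x\<close>, and the orbit from \<open>y\<close> to
      \<open>x\<close> has a step across \<open>?u\<close>. These two steps violate
      \<open>nc\<close>.\<close>
    obtain r where r: "q ((q ^^ r) b) \<le> x" "x < (q ^^ r) b" "a \<le> q ((q ^^ r) b)" "(q ^^ r) b \<le> b"
      using orbit_straddle[OF s, of x] o by auto
    let ?u = "(q ^^ r) b"
    have au: "orbit_rel n q a ?u" using R(1) orbit_rel_funpow by (rule orbit_rel_trans)
    have "orbit_rel n q a (q ?u)" using orbit_rel_trans[OF R(1) orbit_rel_funpow[of b "Suc r"]] by simp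
    then have u: "q ?u < x" using nR r by (cases "q ?u = x") auto
    obtain r' where r': "q ((q ^^ r') y) \<le> ?u" "?u < (q ^^ r') y" "x \<le> q ((q ^^ r') y)" "(q ^^ r') y \<le> y"
      using orbit_straddle[OF t, of ?u] o r by auto
    let ?v = "(q ^^ r') y"
    have "orbit_rel n q x (q ?v)" using orbit_rel_trans[OF R(2) orbit_rel_funpow[of y "Suc r'"]] by simp
    then have "q ?v \<noteq> ?u" using nR orbit_rel_trans[OF au orbit_rel_sym, of x] by auto
    then show False using nc[of ?u ?v] u r r' o by linarith
  qed
qed (rule orbit_rel_sym orbit_rel_trans; assumption)+

lemma prev_orbit_rel: "noncrossing_rel.prev (orbit_rel n q) x = q x"
proof (rule noncrossing_rel.prev_eqI[OF noncrossing_orbit_rel])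
  show "q x < x" by (rule less)
  show "orbit_rel n q x (q x)" using orbit_rel_funpow[of x 1] by simp
  fix z assume z: "q x < z" "z < x"
  show "\<not> orbit_rel n q x z"
  proof
    assume "orbit_rel n q x z"
    then obtain s where "1 \<le> s" "(q ^^ s) x = z" using z(2) by (rule orbit_rel_less)
    then show False using funpow_antimono[of 1 s x] z by simp
  qed
qed

end

text \<open>Orthogonality of an arc to its own translate by \<open>n\<close> says that \<open>F x \<ge> x - n\<close> or
  \<open>F x < x - (d - 1) n\<close>; this is what makes folding \<open>F\<close> down to period \<open>n\<close> possible. The class of
  a \<open>k\<close> none of whose gaps is long is the central block; if there is none, the centre lies in the
  shortest of the long gaps.\<close>

lemma pred_system_is_cover:
  assumes F: "pred_system n (d * n) F" and d: "1 \<le> d"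
  obtains R f k where "noncrossing_rel n R" "F = noncrossing_rel.cover n R d f k"
proof -
  interpret F: pred_system n "d * n" F by fact
  define e where "e = (d - 1) * n"
  note n_pos = F.n_pos
  have e: "0 \<le> e" "d * n = e + n" "n dvd e" "d \<noteq> 1 \<Longrightarrow> n \<le> e"
    using d n_pos by (auto simp: e_def algebra_simps mult_le_cancel_right2)
  define c where "c x \<longleftrightarrow> F x < x - n" for x
  define q where "q x = F x + (if c x then e else 0)" for x
  have long: "F x < x - e" if "c x" for x
  proof (rule ccontr)
    assume a: "\<not> F x < x - e"
    have p: "F (x - n) = F x - n" using F.period_mult[of x "-1"] by simp
    show False by (rule F.nc[of "x - n" x]) (use a p that n_pos e(2) in \<open>auto simp: c_def\<close>)
  qed
  have c_dvd: "c y \<longleftrightarrow> c x" and q_dvd: "q y = q x + (y - x)" if "n dvd y - x" for x y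
    using F.period_dvd[OF that] by (auto simp: c_def q_def)
  have Fc: "F x = q x - e" if "c x" for x using that by (simp add: q_def)
  have Fn: "F x = q x" if "\<not> c x" for x using that by (simp add: q_def)
  have qc: "closed_pred_system n q"
  proof
    show "0 < n" "n dvd n" using n_pos by auto
    fix x
    show "q x < x" using F.less[of x] long[of x] by (auto simp: q_def)
    show "x - n \<le> q x" using F.ge[of x] e(2) by (auto simp: q_def c_def)
    show "q (x + n) = q x + n" using q_dvd[of "x + n" x] by simp
  next
    fix x' x assume a: "q x' \<le> q x" "q x < x'" "x' < x" "x \<le> q x' + n"
    show False
    proof (cases "c x \<and> \<not> c x'")
      case True
      \<comment> \<open>Only the arc of \<open>x\<close> was shortened; its translate by
        \<open>e\<close> has the \<open>F\<close>-value \<open>q x\<close> and can be compared with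
        the arc of \<open>x'\<close>.\<close>
      have "F (x + e) = q x" using F.period_dvd[of "x + e" x] e True by (simp add: q_def)
      then show False using F.nc[of x' "x + e"] a True e Fn[of x'] by simp
    next
      case False
      then have "F x' \<le> F x" "F x < x'" "x \<le> F x' + d * n" using a e(1,2) by (auto simp: q_def split: if_splits)
      then show False using F.nc[of x' x] a by blast
    qed
  qed
  interpret closed_pred_system n q by (rule qc)
  let ?R = "orbit_rel n q"
  interpret R: noncrossing_rel n ?R by (rule noncrossing_orbit_rel)
  have prev: "R.prev = q" by (rule ext) (rule prev_orbit_rel)
  show ?thesis
  proof (cases "d = 1")
    case True
    then have "F x = q x" for x using e by (simp add: q_def e_def)
    \<comment> \<open>With \<open>d = 1\<close> nothing is lengthened, so any position of the centre
      serves.\<close>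
    then have "F = R.cover d False 0" using True by (intro ext) (simp add: R.cover_def prev)
    then show ?thesis using that R.noncrossing_rel_axioms by blast
  next
    case False
    then have ne: "n \<le> e" using e by blast
    \<comment> \<open>The next three facts are \<open>gap_nested\<close>, \<open>gap_cover\<close>
      and \<open>no_disjoint_wraps\<close> with "long" in place of "contains the centre"; each is
      one instance of \<open>nc\<close>.\<close>
    have nested: "c w" if "q w < q x" "x < w" "c x" for x w
    proof (rule ccontr)
      assume "\<not> c w"
      show False
        by (rule F.nc[of x w])
          (use that Fc[OF that(3)] Fn[OF \<open>\<not> c w\<close>] less[of x] ge[of w] ne e(2) in linarith)+
    qed
    have covering: "c x \<or> c z" if "q z < q x" "q x < z" "z < x" "q z + n < x" for x z
    proof (rule ccontr)
      assume "\<not> (c x \<or> c z)"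
      then have "\<not> c x" "\<not> c z" by auto
      note Fn' = this[THEN Fn]
      show False
        by (rule F.nc[of z x]) (use that Fn' ge[of x] ge[of z] ne e(2) in linarith)+
    qed
    have disjoint: False if "x' \<le> q x" "x \<le> q x' + n" "c x" "c x'" for x x'
      by (rule F.nc[of x' x])
        (use that Fc[OF that(3)] Fc[OF that(4)] less[of x'] less[of x] ne e(2) in linarith)+
    have cover_eq: "F = R.cover d f k" if "\<And>x. c x \<longleftrightarrow> R.wrap f k x" for f k
      using that by (intro ext) (simp add: R.cover_def prev e_def[symmetric] Fc Fn)
    \<comment> \<open>Two gaps of one class are disjoint, so \<open>disjoint\<close> allows at most
      one long gap per class.\<close>
    have class_once: "n dvd x - y" if xy: "?R x y" "c x" "c y" for x y
    proof (rule ccontr)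
      assume "\<not> n dvd x - y"
      obtain z where z: "y < z" "z \<le> y + n" "n dvd z - x" by (rule residue_in_interval[OF n_pos])
      have "z \<noteq> y + n"
      proof
        assume "z = y + n"
        then have "n dvd y - x" using z(3) dvd_diff[of n "y + n - x" n] by simp
        then show False using \<open>\<not> n dvd x - y\<close> by (simp add: dvd_diff_commute)
      qed
      then have zy: "z < y + n" using z by simp
      have "?R x z" using R.rel_dvd[OF z(3)] .
      then have Rzy: "?R z y" using xy(1) R.sym R.trans by blast
      have "y \<le> q z" using R.prev_greatest[OF Rzy z(1)] by (simp add: prev)
      moreover have "?R (y + n) z" using R.trans[OF R.sym[OF R.period] R.sym[OF Rzy]] .
      then have "z \<le> q y + n" using R.prev_greatest[of "y + n" z] zy periodic by (simp add: prev)
      ultimately show False using disjoint[of y z] c_dvd[OF z(3)] xy by simp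
    qed
    have hat_lift: "\<exists>z. x < z \<and> z < q x + n \<and> n dvd z - k" if "\<not> R.gap x k" "\<not> ?R x k" for x k
    proof -
      obtain z where z: "x - n < z" "z \<le> x - n + n" "n dvd z - k" by (rule residue_in_interval[OF n_pos])
      have zk: "?R z k" using R.rel_dvd[OF z(3)] by (rule R.sym)
      then have "z \<noteq> x" "z \<noteq> q x" using that R.prev_rel[of x] R.trans[of x "q x" k] unfolding prev by auto
      moreover have "\<not> (q x < z \<and> z < x)" using that zk by (auto simp: R.gap_def prev)
      ultimately have "x < z + n" "z + n < q x + n" using z less[of x] by auto
      moreover have "n dvd z + n - k" using z(3) dvd_add[of n "z - k" n] by (simp add: algebra_simps)
      ultimately show ?thesis by blast
    qed
    show ?thesis
    proof (cases "\<exists>k. \<forall>x. ?R x k \<longrightarrow> \<not> c x")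
      case True
      then obtain k where k: "\<And>x. ?R x k \<Longrightarrow> \<not> c x" by blast
      have "c x \<longleftrightarrow> R.gap x k" for x
      proof
        assume g: "R.gap x k"
        show "c x"
        proof (rule ccontr)
          assume ncx: "\<not> c x"
          obtain z0 where z0: "q x < z0" "z0 < x" "?R z0 k" using g by (auto simp: R.gap_def prev)
          \<comment> \<open>The orbit of \<open>z0\<close> leaves the gap of \<open>x\<close> by a
            step from some \<open>?z\<close>. The gaps of \<open>?z\<close> and \<open>x\<close>
            cover a period, so one is long, and it is not that of \<open>?z\<close>, which lies in
            the class of \<open>k\<close>.\<close>
          obtain t where t: "(q ^^ t) z0 = z0 - n" using orbit_closes by blast
          have "z0 - n \<le> q x" using z0 ge[of x] by simp
          then obtain r where r: "q ((q ^^ r) z0) \<le> q x" "q x < (q ^^ r) z0" "(q ^^ r) z0 \<le> z0"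
            using orbit_straddle[OF t _ z0(1)] by blast
          let ?z = "(q ^^ r) z0"
          have zk: "?R ?z k" using orbit_rel_funpow[of z0 r] z0(3) R.sym R.trans by blast
          have "\<not> ?R x ?z" using R.prev_gap[of x ?z] r z0 by (simp add: prev)
          then have ne: "q ?z \<noteq> q x" using R.prev_eq_prev[of x ?z] by (auto simp: prev)
          have "q ?z + n < x" using nc[of ?z x] r z0 by fastforce
          then show False using covering[of ?z x] r z0 ne ncx k[OF zk] by auto
        qed
      next
        assume cx: "c x"
        show "R.gap x k"
        proof (rule ccontr)
          assume g: "\<not> R.gap x k"
          have "\<not> ?R x k" using k cx by blast
          then obtain z where z: "x < z" "z < q x + n" "n dvd z - k" using hat_lift[OF g] by blast
          have zk: "?R z k" using R.rel_dvd[OF z(3)] by (rule R.sym)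
          \<comment> \<open>The step of this orbit across \<open>q x + n\<close> gives a gap in the
            class of \<open>k\<close> that contains the gap of \<open>x + n\<close>; it would be
            long as well.\<close>
          obtain t where t: "(q ^^ t) (z + n) = z" using orbit_closes[of "z + n"] by auto
          obtain r where r: "q ((q ^^ r) (z + n)) \<le> q x + n" "q x + n < (q ^^ r) (z + n)"
            using orbit_straddle[OF t, of "q x + n"] z less[of x] by auto
          let ?w = "(q ^^ r) (z + n)"
          have wz: "?R ?w z" using R.trans[OF R.period orbit_rel_funpow[of "z + n" r]] by (rule R.sym)
          then have wk: "?R ?w k" using zk by (rule R.trans)
          have nRw: "\<not> ?R (x + n) ?w" using \<open>\<not> ?R x k\<close> R.trans[OF R.period, of x] wk R.trans by blast
          have "q ?w \<noteq> q (x + n)" using R.prev_eq_prev[of "x + n" ?w] nRw by (auto simp: prev)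
          then have "q ?w < q (x + n)" using r periodic by simp
          moreover have "x + n < ?w"
          proof -
            have "\<not> R.gap (x + n) k" using R.gap_dvd[of "x + n" x k] g by simp
            then have "\<not> ?w < x + n" using r wk by (auto simp: R.gap_def prev periodic)
            moreover have "?w \<noteq> x + n" using nRw R.refl[of "x + n"] by auto
            ultimately show ?thesis by simp
          qed
          ultimately have "c ?w" using nested c_dvd[of "x + n" x] cx by simp
          then show False using k[OF wk] by simp
        qed
      qed
      then have "F = R.cover d False k" by (intro cover_eq) (simp add: R.wrap_def)
      then show ?thesis using that R.noncrossing_rel_axioms by blast
    next
      case False
      then obtain k0 where "c k0" by blast
      \<comment> \<open>Now every class has a long gap. Those bounding the region of the centre
        contain no other long gap; a shortest one is of this kind.\<close>
      then obtain k where ck: "c k" and least: "\<And>y. c y \<Longrightarrow> nat (k - q k) \<le> nat (y - q y)"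
        using ex_has_least_nat[of c k0 "\<lambda>x. nat (x - q x)"] by blast
      have min: "z - q z \<le> y - q y" if "n dvd z - k" "c y" for y z
        using least[OF that(2)] q_dvd[OF that(1)] less[of y] less[of k] by simp
      have "c x \<longleftrightarrow> R.wrap True k x" for x
      proof
        assume cx: "c x"
        show "R.wrap True k x"
        proof (rule ccontr)
          assume "\<not> R.wrap True k x"
          then have g: "\<not> R.gap x k" and nd: "\<not> n dvd x - k" by (auto simp: R.wrap_def)
          have nR: "\<not> ?R x k" using class_once[of x k] nd cx ck by blast
          obtain z where z: "x < z" "z < q x + n" "n dvd z - k" using hat_lift[OF g nR] by blast
          have cz: "c z" using c_dvd[OF z(3)] ck by simp
          have zk: "?R z k" using R.rel_dvd[OF z(3)] by (rule R.sym)
          have qzk: "?R (q z) k" using R.trans[OF R.sym[OF R.prev_rel[of z]] zk] by (simp add: prev)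
          \<comment> \<open>Two long gaps are not disjoint. That of \<open>x\<close> does not
            contain that of \<open>z\<close>, so it lies properly inside it, against
            minimality.\<close>
          have qzx: "q z < x" using disjoint[of x z] z cz cx by fastforce
          have "\<not> q x < q z" using g qzk qzx by (auto simp: R.gap_def prev)
          moreover have "\<not> ?R x z" using nR zk R.trans by blast
          then have "q x \<noteq> q z" using R.prev_eq_prev[of x z] unfolding prev by blast
          ultimately show False using min[OF z(3) cx] z(1) by linarith
        qed
      next
        assume "R.wrap True k x"
        then consider "n dvd x - k" | "R.gap x k" by (auto simp: R.wrap_def)
        then show "c x"
        proof cases
          case 1
          then show ?thesis using c_dvd ck by blast
        next
          case 2
          have hat: "\<not> y \<le> q x + n" if "?R y k" "x \<le> y" for y
            using 2 that unfolding R.gap_iff prev by blast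
          have nR: "\<not> ?R x k" using R.gap_not_rel[OF 2] .
          obtain z where z: "x - n < z" "z \<le> x - n + n" "n dvd z - k" by (rule residue_in_interval[OF n_pos])
          have zk: "?R z k" using R.rel_dvd[OF z(3)] by (rule R.sym)
          have "?R (z + n) k" using R.trans[OF R.sym[OF R.period] zk] .
          then have qz: "q x < z" using hat[of "z + n"] z by simp
          have zx: "z < x" using z nR zk by (cases "z = x") auto
          have cz: "c z" using c_dvd[OF z(3)] ck by simp
          have "\<not> ?R x z" using nR zk R.trans by blast
          then have ne: "q z \<noteq> q x" using R.prev_eq_prev[of x z] by (auto simp: prev)
          show ?thesis
          proof (rule ccontr)
            assume ncx: "\<not> c x"
            then have "q z < q x" using nested[of x z] zx cz ne by fastforce
            \<comment> \<open>The class of \<open>x\<close> has a long gap, at \<open>y\<close>,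
              inside the hat from \<open>x\<close> to \<open>q x + n\<close>. The gap of
              \<open>z\<close> properly contains the translate of that hat by \<open>-n\<close>, so
              the gap of \<open>y\<close> is shorter than the minimum.\<close>
            obtain x'' where x'': "?R x'' x" "c x''" using False by blast
            obtain y where y: "x < y" "y \<le> x + n" "n dvd y - x''" by (rule residue_in_interval[OF n_pos])
            have cy: "c y" using c_dvd[OF y(3)] x'' by simp
            have yx: "?R y x" using R.trans[OF R.sym[OF R.rel_dvd[OF y(3)]] x''(1)] .
            have "y \<noteq> x + n" using cy ncx c_dvd[of "x + n" x] by auto
            then have "y < x + n" using y by simp
            moreover have "?R (x + n) y" using R.trans[OF R.sym[OF R.period] R.sym[OF yx]] .
            ultimately have yq: "y \<le> q x + n" using R.prev_greatest[of "x + n" y] periodic by (simp add: prev)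
            have xq: "x \<le> q y" using R.prev_greatest[OF yx y(1)] by (simp add: prev)
            have "?R (q z + n) k"
              using R.trans[OF R.sym[OF R.trans[OF R.prev_rel[of z] R.period]] zk] by (simp add: prev)
            then have "q z + n < x" using hat[of "q z + n"] \<open>q z < q x\<close> by fastforce
            then show False using min[OF z(3) cy] yq xq qz by linarith
          qed
        qed
      qed
      then have "F = R.cover d True k" by (rule cover_eq)
      then show ?thesis using that R.noncrossing_rel_axioms by blast
    qed
  qed
qed

section \<open>When two covers agree\<close>

context noncrossing_rel
begin

lemma gap_shift:
  assumes "gap x k"
  obtains k' where "n dvd k' - k" "prev x < k'" "k' < x"
proof -
  obtain z where z: "prev x < z" "z \<le> prev x + n" "n dvd z - k" by (rule residue_in_interval[OF n_pos])
  have "R z k" using rel_dvd[OF z(3)] by (rule sym)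
  then show ?thesis using that z assms unfolding gap_iff by force
qed

lemma gap_shift_left:
  assumes "gap x k"
  obtains y where "n dvd y - x" "prev y < k" "k < y"
proof -
  obtain k' where k': "n dvd k' - k" "prev x < k'" "k' < x" using assms by (rule gap_shift)
  have "n dvd (x + (k - k')) - x" using k'(1) by (simp add: dvd_diff_commute)
  then show ?thesis using that[of "x + (k - k')"] prev_dvd[of "x + (k - k')" x] k' by simp
qed

text \<open>Placed around the same \<open>k\<close>, both points are the first member of their class
  after \<open>k\<close>.\<close>

lemma gap_unique:
  assumes "R x y" "gap x k" "gap y k"
  shows "n dvd x - y"
proof -
  obtain x' where x': "n dvd x' - x" "prev x' < k" "k < x'" using assms(2) by (rule gap_shift_left)
  obtain y' where y': "n dvd y' - y" "prev y' < k" "k < y'" using assms(3) by (rule gap_shift_left)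
  have R: "R x' y'" using rel_dvd[OF x'(1)] rel_dvd[OF y'(1)] assms(1) sym trans by meson
  have "x' = y'"
    using prev_greatest[OF R] prev_greatest[OF sym[OF R]] x' y' by linarith
  then show ?thesis using x'(1) y'(1) dvd_diff[of n "y' - y" "x' - x"] by simp
qed

lemma gap_exists:
  assumes "\<not> R y k"
  obtains x where "R x y" "gap x k"
proof -
  let ?P = "\<lambda>s. R (k + int s) y"
  obtain z where z: "k < z" "z \<le> k + n" "n dvd z - y" by (rule residue_in_interval[OF n_pos])
  have "?P (nat (z - k))" using z sym[OF rel_dvd[OF z(3)]] by simp
  then have L: "?P (LEAST s. ?P s)" by (rule LeastI)
  define x where "x = k + int (LEAST s. ?P s)"
  have x: "R x y" using L by (simp add: x_def)
  have kx: "k < x" using x assms sym[of k y] unfolding x_def by (cases "LEAST s. ?P s") auto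
  have "prev x < k"
  proof (rule ccontr)
    assume "\<not> prev x < k"
    then have k: "k \<le> prev x" by simp
    have "R (prev x) y" using prev_rel x sym trans by blast
    then have "?P (nat (prev x - k))" using k by simp
    then have "(LEAST s. ?P s) \<le> nat (prev x - k)" by (rule Least_le)
    then show False using prev_less[of x] k by (simp add: x_def)
  qed
  then have "gap x k" unfolding gap_def using kx refl by blast
  then show ?thesis using that x by blast
qed

text \<open>Points \<open>a\<close> and \<open>b\<close> in one gap of a class are not separated by
  members \<open>x\<close>, \<open>y\<close> of that class: once the gap is moved around
  \<open>a\<close>, its hat contains \<open>x\<close> and \<open>y\<close> and hence
  \<open>b\<close>.\<close>

lemma gap_pair:
  assumes "gap g a" "gap g b" "R x g" "R y g" "a < x" "x < b" "b < y" "y < a + n"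
  shows False
proof -
  obtain h where h: "n dvd h - g" "prev h < a" "a < h" using assms(1) by (rule gap_shift_left)
  have R: "R x h" "R y h" using rel_dvd[OF h(1)] assms trans by blast+
  have "h \<le> x"
  proof (rule ccontr)
    assume "\<not> h \<le> x"
    then show False using prev_gap[of h x] sym[OF R(1)] h assms by simp
  qed
  moreover have "R (h + n) y" using trans[OF sym[OF period] sym[OF R(2)]] .
  then have "y \<le> prev h + n" using prev_greatest[of "h + n" y] prev_mult[of h 1] h assms by simp
  moreover have "gap h b" using gap_dvd[OF h(1)] assms(2) by simp
  ultimately show False using refl[of b] assms unfolding gap_iff by force
qed

text \<open>No gap of a class contains the class itself, but every other class lies in one of its
  gaps; so the class of \<open>k\<close> is recovered as the one without wrapped gaps.\<close>

lemma wrap_False_eq_iff: "wrap False k = wrap False k' \<longleftrightarrow> R k k'"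
proof
  assume w: "wrap False k = wrap False k'"
  show "R k k'"
  proof (rule ccontr)
    assume "\<not> R k k'"
    then obtain x where x: "R x k" "gap x k'" by (rule gap_exists)
    have "gap x k" using fun_cong[OF w, of x] x(2) by (simp add: wrap_def)
    then show False using gap_not_rel x(1) by blast
  qed
next
  assume "R k k'"
  then show "wrap False k = wrap False k'" using gap_rel by (auto simp: wrap_def fun_eq_iff)
qed

text \<open>With the centre in a block, that block has no wrapped gap; with the centre in a gap,
  every block has one.\<close>

lemma wrap_False_neq_True: "wrap False k \<noteq> wrap True k'"
proof
  assume w: "wrap False k = wrap True k'"
  have "\<exists>x. R x k \<and> wrap True k' x"
  proof (cases "R k k'")
    case True
    then show ?thesis using sym[OF True] by (intro exI[of _ k']) (simp add: wrap_def)
  next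
    case False
    then obtain x where "R x k" "gap x k'" by (rule gap_exists)
    then show ?thesis by (auto simp: wrap_def)
  qed
  then obtain x where x: "R x k" "wrap True k' x" by blast
  then have "gap x k" using fun_cong[OF w, of x] by (simp add: wrap_def)
  then show False using gap_not_rel x(1) by blast
qed

section \<open>Different names for the same region: merging two classes\<close>

definition join_rel :: "int \<Rightarrow> int \<Rightarrow> int \<Rightarrow> int \<Rightarrow> bool" where
  "join_rel k k' x y \<longleftrightarrow> R x y \<or> (R x k \<or> R x k') \<and> (R y k \<or> R y k')"

definition hats_disjoint :: "int \<Rightarrow> int \<Rightarrow> bool" where
  "hats_disjoint k k' \<longleftrightarrow>
     (\<forall>z z'. k \<le> z \<longrightarrow> z \<le> prev k + n \<longrightarrow> k' \<le> z' \<longrightarrow> z' \<le> prev k' + n \<longrightarrow> \<not> n dvd z - z')"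

lemma hats_disjoint_sym: "hats_disjoint k k' \<Longrightarrow> hats_disjoint k' k"
  unfolding hats_disjoint_def by (metis dvd_diff_commute)

lemma join_rel_commute: "join_rel k k' = join_rel k' k"
  by (auto simp: join_rel_def fun_eq_iff)

lemma hats_disjoint_gap:
  assumes "hats_disjoint k k'" shows "gap k k'"
  unfolding gap_iff
proof (intro allI impI notI)
  fix z assume z: "R z k'" "k \<le> z" "z \<le> prev k + n"
  obtain z' where z': "prev k' < z'" "z' \<le> prev k' + n" "n dvd z' - z" by (rule residue_in_interval[OF n_pos])
  have "R k' z'" using rel_dvd[OF z'(3)] z(1) sym trans by blast
  then have "k' \<le> z'" using prev_gap[of k' z'] z' by force
  then show False using assms z z' unfolding hats_disjoint_def by (metis dvd_diff_commute)
qed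

lemma hats_disjoint_if_gap:
  assumes "gap k k'" "gap k' k" shows "hats_disjoint k k'"
  unfolding hats_disjoint_def
proof (intro allI impI notI)
  fix z z' assume z: "k \<le> z" "z \<le> prev k + n" "k' \<le> z'" "z' \<le> prev k' + n" "n dvd z - z'"
  \<comment> \<open>The lift \<open>j\<close> of \<open>k'\<close> makes the two hats overlap as
    intervals at \<open>z\<close>. The larger of \<open>k\<close> and \<open>j\<close> then lies in
    the other hat, contrary to one of the gaps.\<close>
  define j where "j = k' + (z - z')"
  have j: "n dvd j - k'" using z(5) by (simp add: j_def)
  have pj: "prev j = prev k' + (z - z')" using prev_dvd[OF j] by (simp add: j_def)
  have "R j k'" using rel_dvd[OF j] by (rule sym)
  then have "\<not> k \<le> j" using assms(1) z unfolding gap_iff j_def by force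
  moreover have "gap j k" using gap_dvd[OF j] assms(2) by simp
  ultimately show False using refl[of k] z pj unfolding gap_iff j_def by force
qed

lemma join_noncrossing:
  assumes w: "wrap True k = wrap True k'" and nR: "\<not> R k k'"
  shows "noncrossing_rel n (join_rel k k')"
proof
  let ?K = "\<lambda>x. R x k \<or> R x k'"
  have K: "R x y \<Longrightarrow> ?K x \<Longrightarrow> ?K y" for x y using sym trans by blast
  show "0 < n" by (rule n_pos)
  show "join_rel k k' x x" for x by (simp add: join_rel_def refl)
  show "join_rel k k' x (x + n)" for x by (simp add: join_rel_def period)
  show "join_rel k k' x y \<Longrightarrow> join_rel k k' y x" for x y
    unfolding join_rel_def using sym by blast
  show "join_rel k k' x y \<Longrightarrow> join_rel k k' y z \<Longrightarrow> join_rel k k' x z" for x y z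
    unfolding join_rel_def using trans K sym by meson
  \<comment> \<open>A third class has a gap containing \<open>k\<close>, and equality of the wraps
    puts \<open>k'\<close> into the same gap. Hence \<open>gap_pair\<close> applies to members of
    the merged class.\<close>
  have sep: False if o: "a < x" "x < b" "b < y" "y < a + n" and ab: "?K a" "?K b" and xy: "R x y" "\<not> ?K x" for a x b y
  proof -
    have "\<not> R x k" using xy by blast
    then obtain g where g: "R g x" "gap g k" by (rule gap_exists)
    have "wrap True k' g" using fun_cong[OF w, of g] g(2) by (simp add: wrap_def)
    moreover have "\<not> n dvd g - k'" using rel_dvd[of g k'] g(1) xy(2) sym trans by blast
    ultimately have "gap g k'" by (simp add: wrap_def)
    then have "gap g a" "gap g b" using g(2) ab gap_rel by blast+
    moreover have "R x g" "R y g" using g(1) xy(1) sym trans by blast+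
    ultimately show False using gap_pair o by blast
  qed
  fix a x b y
  assume o: "a < x" "x < b" "b < y" "y < a + n" and J: "join_rel k k' a b" "join_rel k k' x y"
  show "join_rel k k' a x"
  proof (rule ccontr)
    assume nJ: "\<not> join_rel k k' a x"
    then have nK: "\<not> (?K a \<and> ?K x)" and nRax: "\<not> R a x" by (auto simp: join_rel_def)
    consider "R a b" "R x y" | "?K a" "?K b" "R x y" "\<not> ?K x" | "R a b" "?K x" "?K y" "\<not> ?K a"
      using J nK K unfolding join_rel_def by blast
    then show False
    proof cases
      case 1
      then show False using noncrossing o nRax by blast
    next
      case 2
      then show False using sep o by blast
    next
      case 3
      \<comment> \<open>The window is rotated to \<open>x < b < y < a + n\<close>, which exchanges
        the roles of the two classes.\<close>
      have "R b (a + n)" using 3(1) period sym trans by blast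
      moreover have "\<not> ?K b" using 3 K sym by blast
      ultimately show False using sep[of x b y "a + n"] o 3 by linarith
    qed
  qed
qed

text \<open>For \<open>x\<close> in a third class, a gap containing \<open>k\<close> but not
  \<open>k'\<close> would be bounded by a chord that crosses the merged class. In the class of
  \<open>k'\<close>, only the gap of \<open>k'\<close> contains \<open>k\<close>.\<close>

lemma wrap_True_imp:
  assumes D: "hats_disjoint k k'" and J: "noncrossing_rel n (join_rel k k')" and w: "wrap True k x"
  shows "wrap True k' x"
proof (cases "n dvd x - k")
  case True
  then show ?thesis using gap_dvd hats_disjoint_gap[OF D] by (auto simp: wrap_def)
next
  case False
  then have g: "gap x k" using w by (simp add: wrap_def)
  have k: "gap k' k" by (rule hats_disjoint_gap[OF hats_disjoint_sym[OF D]])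
  show ?thesis
  proof (cases "R x k'")
    case True
    then show ?thesis using gap_unique[OF True g k] by (simp add: wrap_def)
  next
    case nRk': False
    have nRk: "\<not> R x k" by (rule gap_not_rel[OF g])
    have "gap x k'"
    proof (rule ccontr)
      assume "\<not> gap x k'"
      then obtain z where z: "R z k'" "x \<le> z" "z \<le> prev x + n" unfolding gap_iff by blast
      have "R x (prev x + n)" using prev_rel period trans by blast
      then have "z \<noteq> prev x + n" using z(1) nRk' trans by blast
      moreover have "z \<noteq> x" using z(1) nRk' by blast
      moreover obtain j where j: "n dvd j - k" "prev x < j" "j < x" using g by (rule gap_shift)
      moreover have jk: "R j k" using rel_dvd[OF j(1)] by (rule sym)
      moreover have "join_rel k k' (prev x) x" using sym[OF prev_rel] by (simp add: join_rel_def)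
      moreover have "join_rel k k' j z" using jk z(1) by (simp add: join_rel_def)
      ultimately have "join_rel k k' (prev x) j"
        using noncrossing_rel.noncrossing[OF J, of "prev x" j x z] z by linarith
      then have "R (prev x) k \<or> R (prev x) k'" using jk trans unfolding join_rel_def by blast
      then show False using prev_rel nRk nRk' trans by blast
    qed
    then show ?thesis by (simp add: wrap_def)
  qed
qed

lemma wrap_True_eq_iff:
  "wrap True k = wrap True k' \<longleftrightarrow>
     (n dvd k - k' \<or> hats_disjoint k k') \<and> noncrossing_rel n (join_rel k k')"
proof (cases "n dvd k - k'")
  case True
  have R: "R k k'" using rel_dvd[OF True] by (rule sym)
  have "join_rel k k' = R"
  proof (intro ext)
    fix x y
    have "R z k' \<longleftrightarrow> R z k" for z using R sym trans by blast
    moreover have "R x k \<Longrightarrow> R y k \<Longrightarrow> R x y" using sym trans by blast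
    ultimately show "join_rel k k' x y = R x y" unfolding join_rel_def by blast
  qed
  moreover have "n dvd x - k \<longleftrightarrow> n dvd x - k'" for x
    using True dvd_add_left_iff[of n "k - k'" "x - k"] by simp
  then have "wrap True k = wrap True k'" using gap_rel[OF R] by (auto simp: wrap_def fun_eq_iff)
  ultimately show ?thesis using True noncrossing_rel_axioms by simp
next
  case False
  show ?thesis
  proof
    assume w: "wrap True k = wrap True k'"
    have "wrap True k' k" "wrap True k k'" using fun_cong[OF w, of k] fun_cong[OF w, of k'] by (simp_all add: wrap_def)
    then have g: "gap k k'" "gap k' k" using False by (auto simp: wrap_def dvd_diff_commute)
    then show "(n dvd k - k' \<or> hats_disjoint k k') \<and> noncrossing_rel n (join_rel k k')"
      using join_noncrossing[OF w gap_not_rel] hats_disjoint_if_gap by blast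
  next
    assume "(n dvd k - k' \<or> hats_disjoint k k') \<and> noncrossing_rel n (join_rel k k')"
    then have D: "hats_disjoint k k'" and J: "noncrossing_rel n (join_rel k k')" using False by auto
    show "wrap True k = wrap True k'"
    proof (intro ext iffI)
      fix x assume "wrap True k x"
      then show "wrap True k' x" by (rule wrap_True_imp[OF D J])
    next
      fix x assume "wrap True k' x"
      then show "wrap True k x" by (rule wrap_True_imp[OF hats_disjoint_sym[OF D] J[unfolded join_rel_commute[of k k']]])
    qed
  qed
qed

end

section \<open>Recovering the partition and the wrapped gaps from a cover\<close>

lemma rel_if_prev_eq:
  assumes R: "noncrossing_rel n R" and R': "noncrossing_rel n R'"
    and eq: "noncrossing_rel.prev R = noncrossing_rel.prev R'"
  shows "R = R'"
proof -
  have *: "R' x y" if R: "noncrossing_rel n R" and R': "noncrossing_rel n R'"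
    and eq: "noncrossing_rel.prev R = noncrossing_rel.prev R'" and "R x y" "y \<le> x" for x y R R'
  proof -
    interpret R: noncrossing_rel n R by fact
    interpret R': noncrossing_rel n R' by fact
    show ?thesis using that(4,5)
    proof (induction "nat (x - y)" arbitrary: x rule: less_induct)
      case less
      show ?case
      proof (cases "x = y")
        case True then show ?thesis by (simp add: R'.refl)
      next
        case False
        then have "y \<le> R.prev x" using R.prev_greatest less.prems by simp
        moreover have "R (R.prev x) y" using R.prev_rel less.prems R.sym R.trans by blast
        ultimately have "R' (R.prev x) y" using less.hyps[of "R.prev x"] R.prev_less[of x] by simp
        then show ?thesis using R'.prev_rel R'.trans unfolding eq by blast
      qed
    qed
  qed
  interpret R: noncrossing_rel n R by fact
  interpret R': noncrossing_rel n R' by fact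
  show ?thesis
  proof (intro ext iffI)
    fix x y assume "R x y"
    then show "R' x y"
      using *[OF R R' eq, of x y] R'.sym[OF *[OF R R' eq, of y x]] R.sym[of x y] by linarith
  next
    fix x y assume "R' x y"
    then show "R x y"
      using *[OF R' R eq[symmetric], of x y] R.sym[OF *[OF R' R eq[symmetric], of y x]] R'.sym[of x y] by linarith
  qed
qed

text \<open>For \<open>d \<ge> 2\<close> a lengthened value lies below \<open>x - n\<close> and a
  plain one does not, so the value of a cover reveals both \<open>wrap\<close> and
  \<open>prev\<close>.\<close>

lemma cover_eq_iff:
  assumes R: "noncrossing_rel n R" and R': "noncrossing_rel n R'" and d: "2 \<le> d"
  shows "noncrossing_rel.cover n R d f k = noncrossing_rel.cover n R' d f' k' \<longleftrightarrow>
    R = R' \<and> noncrossing_rel.wrap n R f k = noncrossing_rel.wrap n R f' k'"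
proof -
  interpret R: noncrossing_rel n R by fact
  interpret R': noncrossing_rel n R' by fact
  define e where "e = (d - 1) * n"
  have e: "n \<le> e" using d R.n_pos by (simp add: e_def mult_le_cancel_right1)
  have key: "R.prev x = R'.prev x \<and> R.wrap f k x = R'.wrap f' k' x"
    if "R.cover d f k x = R'.cover d f' k' x" for x
    using that e R.prev_less[of x] R'.prev_less[of x] R.prev_ge[of x] R'.prev_ge[of x]
    unfolding R.cover_def R'.cover_def e_def[symmetric] by (auto split: if_splits)
  show ?thesis
  proof
    assume eq: "R.cover d f k = R'.cover d f' k'"
    then have "R.prev = R'.prev" "R.wrap f k = R'.wrap f' k'"
      using key[OF fun_cong[OF eq]] by (auto simp: fun_eq_iff)
    then show "R = R' \<and> R.wrap f k = R.wrap f' k'" using rel_if_prev_eq[OF R R'] by simp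
  next
    assume "R = R' \<and> R.wrap f k = R.wrap f' k'"
    then have eq: "R' = R" and w: "R.wrap f k = R.wrap f' k'" by blast+
    show "R.cover d f k = R'.cover d f' k'" unfolding eq by (simp add: R.cover_def w fun_eq_iff)
  qed
qed

section \<open>Partitions of the vertex set\<close>

definition part_rel :: "nat \<Rightarrow> nat set set \<Rightarrow> int \<Rightarrow> int \<Rightarrow> bool" where
  "part_rel n p x y \<longleftrightarrow> (\<exists>B\<in>p. cyc n x \<in> B \<and> cyc n y \<in> B)"

lemma cyc_dvd: "0 < n \<Longrightarrow> int n dvd int (cyc n x) - x"
  using cyc_eq_iff[of n "int (cyc n x)" x] cyc_of_nat[OF cyc_range[of n x]] by simp

lemma cyc_in_period: "0 < n \<Longrightarrow> 0 < z \<Longrightarrow> z \<le> 2 * int n \<Longrightarrow> int (cyc n z) = (if z \<le> int n then z else z - int n)"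
proof -
  assume a: "0 < n" "0 < z" "z \<le> 2 * int n"
  let ?w = "if z \<le> int n then z else z - int n"
  have w: "nat ?w \<in> {1..n}" using a by auto
  have "cyc n z = cyc n (int (nat ?w))" using a by (auto simp: cyc_eq_iff)
  also have "\<dots> = nat ?w" using w by (rule cyc_of_nat)
  finally show ?thesis using a by simp
qed

context
  fixes n :: nat and p :: "nat set set"
  assumes n: "0 < n" and p: "partition_on {1..n} p"
begin

lemma blocks_eq: "B \<in> p \<Longrightarrow> B' \<in> p \<Longrightarrow> i \<in> B \<Longrightarrow> i \<in> B' \<Longrightarrow> B = B'"
  using p by (auto simp: partition_on_def disjoint_def)

lemma ex_block: "i \<in> {1..n} \<Longrightarrow> \<exists>B\<in>p. i \<in> B"
  using p by (auto simp: partition_on_def)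

lemma block_subset: "B \<in> p \<Longrightarrow> B \<subseteq> {1..n}"
  using p by (auto simp: partition_on_def)

lemma block_eqI: "B \<in> p \<Longrightarrow> i \<in> B \<Longrightarrow> block p i = B"
  unfolding block_def by (rule the_equality) (auto dest: blocks_eq)

lemma block_mem: "i \<in> {1..n} \<Longrightarrow> block p i \<in> p" "i \<in> {1..n} \<Longrightarrow> i \<in> block p i"
  using ex_block block_eqI by metis+

lemma part_rel_iff_block: "part_rel n p x y \<longleftrightarrow> cyc n y \<in> block p (cyc n x)"
  unfolding part_rel_def using block_mem[OF cyc_range[OF n, of x]] block_eqI by metis

lemma block_eq: "i \<in> {1..n} \<Longrightarrow> block p i = {j \<in> {1..n}. part_rel n p (int i) (int j)}"
  using block_subset[OF block_mem(1), of i] by (auto simp: part_rel_iff_block cyc_of_nat)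

lemma block_eq_iff:
  assumes "i \<in> {1..n}" "j \<in> {1..n}"
  shows "block p i = block p j \<longleftrightarrow> part_rel n p (int i) (int j)"
  unfolding part_rel_iff_block using assms block_mem block_eqI by (metis cyc_of_nat)

lemma part_rel_dvd: "int n dvd x - x' \<Longrightarrow> int n dvd y - y' \<Longrightarrow> part_rel n p x y \<longleftrightarrow> part_rel n p x' y'"
  unfolding part_rel_def using cyc_eq_iff[OF n, of x x'] cyc_eq_iff[OF n, of y y'] by simp

text \<open>The linear condition on \<open>{1..n}\<close> already implies the cyclic one: rotating
  four crossing points leaves them crossing and at most exchanges the two blocks.\<close>

lemma noncrossing_iff: "noncrossing n p \<longleftrightarrow> noncrossing_rel (int n) (part_rel n p)"
proof
  assume nc: "noncrossing n p"
  have no: False if "B \<in> p" "B' \<in> p" "B \<noteq> B'" "a \<in> B" "b \<in> B" "x \<in> B'" "y \<in> B'" "a < x" "x < b" "b < y" for B B' a b x y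
  proof -
    have "\<exists>B\<in>p. \<exists>B'\<in>p. B \<noteq> B' \<and> (\<exists>a x b y. a \<in> B \<and> b \<in> B \<and> x \<in> B' \<and> y \<in> B' \<and> a < x \<and> x < b \<and> b < y)"
      by (rule bexI[OF _ that(1)], rule bexI[OF _ that(2)], intro conjI exI) (rule that)+
    then show False using nc unfolding noncrossing_def by (elim conjE notE)
  qed
  show "noncrossing_rel (int n) (part_rel n p)"
  proof
    show "0 < int n" using n by simp
    show "part_rel n p x x" for x using ex_block[OF cyc_range[OF n, of x]] by (auto simp: part_rel_def)
    then show "part_rel n p x (x + int n)" for x using part_rel_dvd[of x x x "x + int n"] by simp
    show "part_rel n p x y \<Longrightarrow> part_rel n p y x" for x y by (auto simp: part_rel_def)
    show "part_rel n p x y \<Longrightarrow> part_rel n p y z \<Longrightarrow> part_rel n p x z" for x y z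
      unfolding part_rel_def using blocks_eq[of _ _ "cyc n y"] by blast
    fix a x b y :: int
    assume o: "a < x" "x < b" "b < y" "y < a + int n" and R: "part_rel n p a b" "part_rel n p x y"
    show "part_rel n p a x"
    proof (rule ccontr)
      assume nR: "\<not> part_rel n p a x"
      obtain B where B: "B \<in> p" "cyc n a \<in> B" "cyc n b \<in> B" using R(1) by (auto simp: part_rel_def)
      obtain B' where B': "B' \<in> p" "cyc n x \<in> B'" "cyc n y \<in> B'" using R(2) by (auto simp: part_rel_def)
      have ne: "B \<noteq> B'" using B B' nR by (auto simp: part_rel_def)
      define s where "s = int (cyc n a) - a"
      have a: "1 \<le> a + s" "a + s \<le> int n" using cyc_range[OF n, of a] by (auto simp: s_def)
      have c: "int (cyc n z) = (if z + s \<le> int n then z + s else z + s - int n)" if "a \<le> z" "z < a + int n" for z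
      proof -
        have "cyc n z = cyc n (z + s)" using cyc_dvd[OF n, of a] by (simp add: cyc_eq_iff[OF n] s_def dvd_diff_commute)
        then show ?thesis using cyc_in_period[OF n, of "z + s"] a that by auto
      qed
      note cs = c[of a] c[of x] c[of b] c[of y]
      \<comment> \<open>The shift by \<open>s\<close> brings \<open>a\<close> into
        \<open>{1..n}\<close>; the cases say how many of the other three points then exceed
        \<open>n\<close> and wrap around.\<close>
      consider "y + s \<le> int n" | "b + s \<le> int n" "int n < y + s" | "x + s \<le> int n" "int n < b + s" | "int n < x + s"
        by linarith
      then show False
      proof cases
        case 1
        then have "cyc n a < cyc n x" "cyc n x < cyc n b" "cyc n b < cyc n y" using cs o a by auto
        then show False using no[OF B(1) B'(1) ne B(2,3) B'(2,3)] by blast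
      next
        case 2
        then have "cyc n y < cyc n a" "cyc n a < cyc n x" "cyc n x < cyc n b" using cs o a by auto
        then show False using no[OF B'(1) B(1) ne[symmetric] B'(3,2) B(2,3)] by blast
      next
        case 3
        then have "cyc n b < cyc n y" "cyc n y < cyc n a" "cyc n a < cyc n x" using cs o a by auto
        then show False using no[OF B(1) B'(1) ne B(3,2) B'(3,2)] by blast
      next
        case 4
        then have "cyc n x < cyc n b" "cyc n b < cyc n y" "cyc n y < cyc n a" using cs o a by auto
        then show False using no[OF B'(1) B(1) ne[symmetric] B'(2,3) B(3,2)] by blast
      qed
    qed
  qed
next
  assume "noncrossing_rel (int n) (part_rel n p)"
  then interpret noncrossing_rel "int n" "part_rel n p" .
  show "noncrossing n p" unfolding noncrossing_def
  proof (intro conjI p notI)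
    assume "\<exists>B\<in>p. \<exists>B'\<in>p. B \<noteq> B' \<and> (\<exists>a x b y. a \<in> B \<and> b \<in> B \<and> x \<in> B' \<and> y \<in> B' \<and> a < x \<and> x < b \<and> b < y)"
    then obtain B B' a x b y where B: "B \<in> p" "B' \<in> p" "B \<noteq> B'" "a \<in> B" "b \<in> B" "x \<in> B'" "y \<in> B'"
      and o: "a < x" "x < b" "b < y" by blast
    have r: "a \<in> {1..n}" "b \<in> {1..n}" "x \<in> {1..n}" "y \<in> {1..n}" using B block_subset by blast+
    have "part_rel n p (int a) (int b)" "part_rel n p (int x) (int y)"
      using B r by (auto simp: part_rel_def cyc_of_nat)
    then have "part_rel n p (int a) (int x)" using noncrossing[of "int a" "int x" "int b" "int y"] o r by auto
    then have "x \<in> B" using B r block_eqI by (simp add: part_rel_iff_block cyc_of_nat)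
    then show False using blocks_eq B by blast
  qed
qed

end

lemma eq_iff_dvd:
  assumes n: "0 < n" and ik: "i \<in> {1..n}" "k \<in> {1..n}"
  shows "i = k \<longleftrightarrow> int n dvd int i - int k"
  using cyc_eq_iff[OF n, of "int i" "int k"] ik by (simp add: cyc_of_nat)

lemma part_rel_inj:
  assumes n: "0 < n" and p: "partition_on {1..n} p" and p': "partition_on {1..n} p'"
    and eq: "part_rel n p = part_rel n p'"
  shows "p = p'"
proof -
  have *: "B \<in> p'" if p: "partition_on {1..n} p" and p': "partition_on {1..n} p'"
    and eq: "part_rel n p = part_rel n p'" and B: "B \<in> p" for p p' B
  proof -
    have "B \<noteq> {}" using B p by (auto simp: partition_on_def)
    then obtain i where i: "i \<in> B" by blast
    then have r: "i \<in> {1..n}" using block_subset[OF n p B] by blast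
    have "B = block p i" using block_eqI[OF n p B i] ..
    also have "\<dots> = block p' i" using block_eq[OF n p r] block_eq[OF n p' r] eq by simp
    finally show ?thesis using block_mem(1)[OF n p' r] by simp
  qed
  show ?thesis using *[OF p p' eq] *[OF p' p eq[symmetric]] by blast
qed

lemma ex_partition:
  assumes R: "noncrossing_rel (int n) R"
  obtains p where "noncrossing n p" "part_rel n p = R"
proof -
  interpret noncrossing_rel "int n" R by fact
  have n: "0 < n" using n_pos by simp
  define p where "p = (\<lambda>i. {j \<in> {1..n}. R (int i) (int j)}) ` {1..n}"
  have part: "partition_on {1..n} p"
  proof (rule partition_onI)
    show "\<Union> p = {1..n}" using refl by (auto simp: p_def)
    show "{} \<notin> p" using refl by (auto simp: p_def)
    fix B B' assume B: "B \<in> p" "B' \<in> p" "B \<noteq> B'"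
    obtain i i' where i: "B = {j \<in> {1..n}. R (int i) (int j)}" "B' = {j \<in> {1..n}. R (int i') (int j)}"
      using B by (auto simp: p_def)
    show "disjnt B B'"
    proof (rule ccontr)
      assume "\<not> disjnt B B'"
      then obtain j where "R (int i) (int j)" "R (int i') (int j)" by (auto simp: i disjnt_def)
      then have "R (int i) (int i')" using sym trans by blast
      then have "R (int i) z \<longleftrightarrow> R (int i') z" for z using sym trans by blast
      then show False using B(3) by (simp add: i)
    qed
  qed
  have "part_rel n p = R"
  proof (intro ext)
    fix x y
    have r: "cyc n x \<in> {1..n}" "cyc n y \<in> {1..n}" by (rule cyc_range[OF n])+
    have x: "R x (int (cyc n x))" "R y (int (cyc n y))" by (rule rel_dvd[OF cyc_dvd[OF n]])+
    have "part_rel n p x y \<longleftrightarrow> R (int (cyc n x)) (int (cyc n y))"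
    proof
      assume "part_rel n p x y"
      then obtain i where "R (int i) (int (cyc n x))" "R (int i) (int (cyc n y))"
        by (auto simp: part_rel_def p_def)
      then show "R (int (cyc n x)) (int (cyc n y))" using sym trans by blast
    next
      assume "R (int (cyc n x)) (int (cyc n y))"
      then show "part_rel n p x y" unfolding part_rel_def p_def bex_simps
        using r refl by (intro bexI[of _ "cyc n x"]) auto
    qed
    also have "\<dots> \<longleftrightarrow> R x y" using x sym trans by meson
    finally show "part_rel n p x y = R x y" .
  qed
  then show ?thesis using that noncrossing_iff[OF n part] R by simp
qed

section \<open>The systems L and S in integer coordinates\<close>

text \<open>Division of \<open>m - 1\<close> by \<open>n\<close> separates the data: the remainder
  fixes the socle, the quotient counts the repetitions of the top.\<close>

lemma Mmod_eq:
  assumes i: "i \<in> {1..n}" and x: "int i \<le> x" "x < int i + int n"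
  shows "Mmod n i (cyc n x) t = (i, nat (x - int i) + t * n + 1)"
proof -
  have n: "0 < n" using i by auto
  let ?r = "nat (x - int i)"
  have r: "?r < n" "int ?r = x - int i" using x by auto
  have vert_iff: "vert n i a = cyc n x \<longleftrightarrow> a mod n = ?r" for a
  proof -
    have "vert n i a = cyc n x \<longleftrightarrow> int n dvd int a - int ?r"
      unfolding vert_def cyc_eq_iff[OF n] r(2) by (simp add: algebra_simps)
    also have "\<dots> \<longleftrightarrow> a mod n = ?r mod n"
      by (metis mod_eq_dvd_iff of_nat_mod of_nat_eq_iff)
    finally show ?thesis using r(1) by simp
  qed
  have top_iff: "vert n i a = i \<longleftrightarrow> n dvd a" for a
    using cyc_eq_iff[OF n, of "int i + int a" "int i"] cyc_of_nat[OF i] by (simp add: vert_def)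
  have count: "card {a. a < m \<and> vert n i a = i} = (m - 1) div n + 1" if "1 \<le> m" for m
  proof -
    have "{a. a < m \<and> vert n i a = i} = (\<lambda>c. c * n) ` {..(m - 1) div n}"
    proof (intro set_eqI iffI)
      fix a assume "a \<in> {a. a < m \<and> vert n i a = i}"
      then have "a \<le> m - 1" and "n dvd a" using that by (auto simp: top_iff)
      then show "a \<in> (\<lambda>c. c * n) ` {..(m - 1) div n}"
        by (intro image_eqI[of _ _ "a div n"]) (auto intro: div_le_mono)
    next
      fix a assume "a \<in> (\<lambda>c. c * n) ` {..(m - 1) div n}"
      then obtain c where c: "a = c * n" "c \<le> (m - 1) div n" by auto
      have "c * n \<le> (m - 1) div n * n" using c(2) by (rule mult_le_mono1)
      also have "\<dots> \<le> m - 1" by simp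
      finally show "a \<in> {a. a < m \<and> vert n i a = i}" using that c by (simp add: top_iff)
    qed
    moreover have "inj_on (\<lambda>c. c * n) {..(m - 1) div n}" using n by (auto intro: inj_onI)
    ultimately show ?thesis by (simp add: card_image)
  qed
  have "(THE m. 1 \<le> m \<and> vert n i (m - 1) = cyc n x \<and> card {a. a < m \<and> vert n i a = i} = t + 1)
      = ?r + t * n + 1"
  proof (rule the_equality)
    show "1 \<le> ?r + t * n + 1 \<and> vert n i (?r + t * n + 1 - 1) = cyc n x
        \<and> card {a. a < ?r + t * n + 1 \<and> vert n i a = i} = t + 1"
      using r(1) n count[of "?r + t * n + 1"] by (simp add: vert_iff)
    fix m assume m: "1 \<le> m \<and> vert n i (m - 1) = cyc n x \<and> card {a. a < m \<and> vert n i a = i} = t + 1"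
    then have "(m - 1) mod n = ?r" "(m - 1) div n = t" using count[of m] by (auto simp: vert_iff)
    then have "m - 1 = t * n + ?r" using div_mult_mod_eq[of "m - 1" n] by simp
    then show "m = ?r + t * n + 1" using m by linarith
  qed
  then show ?thesis by (simp add: Mmod_def)
qed

context
  fixes n :: nat and p :: "nat set set"
  assumes nc: "noncrossing n p" and n: "0 < n"
begin

lemma partition: "partition_on {1..n} p"
  using nc by (simp add: noncrossing_def)

interpretation noncrossing_rel "int n" "part_rel n p"
  using noncrossing_iff[OF n partition] nc by simp

lemma kk_eq: "i \<in> {1..n} \<Longrightarrow> kk n p i = cyc n (prev (int i))"
  unfolding kk_def prev_def by (simp add: part_rel_iff_block[OF n partition] cyc_of_nat)

lemma kk_offset:
  assumes "i \<in> {1..n}"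
  shows "(int (kk n p i) - int i) mod int n = prev (int i) + int n - int i"
proof -
  have d: "int n dvd int (kk n p i) - prev (int i)" unfolding kk_eq[OF assms] by (rule cyc_dvd[OF n])
  have eq: "int (kk n p i) - int i - (prev (int i) + int n - int i) = int (kk n p i) - prev (int i) - int n" by simp
  have "int n dvd int (kk n p i) - int i - (prev (int i) + int n - int i)"
    unfolding eq by (rule dvd_diff[OF d dvd_refl])
  then have "(int (kk n p i) - int i) mod int n = (prev (int i) + int n - int i) mod int n"
    by (simp only: mod_eq_dvd_iff)
  also have "\<dots> = prev (int i) + int n - int i"
    using prev_less[of "int i"] prev_ge[of "int i"] by (intro mod_pos_pos_trivial) auto
  finally show ?thesis .
qed

lemma hat_eq:
  assumes "i \<in> {1..n}"
  shows "hat n p i = cyc n ` {int i..prev (int i) + int n}"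
proof (intro set_eqI iffI)
  fix v assume "v \<in> hat n p i"
  then obtain t where t: "v = cyc n (int i + int t)" "t \<le> nat (prev (int i) + int n - int i)"
    unfolding hat_def kk_offset[OF assms] by auto
  then show "v \<in> cyc n ` {int i..prev (int i) + int n}" using prev_ge[of "int i"] by auto
next
  fix v assume "v \<in> cyc n ` {int i..prev (int i) + int n}"
  then obtain z where z: "v = cyc n z" "int i \<le> z" "z \<le> prev (int i) + int n" by auto
  then show "v \<in> hat n p i"
    unfolding hat_def kk_offset[OF assms] by (auto intro!: exI[of _ "nat (z - int i)"])
qed

text \<open>The hat is the residue image of the complementary interval in \<open>gap_iff\<close>, so
  a hat avoiding a block means that the block lies in the gap.\<close>

lemma hat_block_iff:
  assumes i: "i \<in> {1..n}" and k: "k \<in> {1..n}"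
  shows "hat n p i \<inter> block p k = {} \<longleftrightarrow> gap (int i) (int k)"
proof -
  have "cyc n z \<in> block p k \<longleftrightarrow> part_rel n p z (int k)" for z
    using part_rel_iff_block[OF n partition, of "int k" z] cyc_of_nat[OF k] sym by metis
  moreover have "hat n p i \<inter> block p k = {} \<longleftrightarrow> (\<forall>z\<in>{int i..prev (int i) + int n}. cyc n z \<notin> block p k)"
    unfolding hat_eq[OF i] by blast
  ultimately show ?thesis unfolding gap_iff by auto
qed

lemma hat_disjoint_iff:
  assumes i: "i \<in> {1..n}" and k: "k \<in> {1..n}"
  shows "hat n p i \<inter> hat n p k = {} \<longleftrightarrow> hats_disjoint (int i) (int k)"
  unfolding hat_eq[OF i] hat_eq[OF k] hats_disjoint_def using cyc_eq_iff[OF n] by fastforce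

lemma Mmod_cover:
  assumes i: "i \<in> {1..n}" and d: "0 < d"
  shows "Mmod n i (kk n p i) (if wrap f k (int i) then 0 else d - 1)
    = (i, nat (cover (int d) f k (int i) + int (d * n) - int i + 1))"
proof -
  note b = prev_less[of "int i"] prev_ge[of "int i"]
  have "kk n p i = cyc n (prev (int i) + int n)" using kk_eq[OF i] cyc_eq_iff[OF n] by simp
  then have M: "Mmod n i (kk n p i) t = (i, nat (prev (int i) + int n - int i) + t * n + 1)" for t
    using Mmod_eq[OF i, of "prev (int i) + int n" t] b by simp
  have D: "int (d * n) = (int d - 1) * int n + int n" by (simp add: algebra_simps)
  have D': "int ((d - 1) * n) = (int d - 1) * int n" using d by (simp add: of_nat_diff)
  have "int (nat (prev (int i) + int n - int i) + (if wrap f k (int i) then 0 else d - 1) * n + 1)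
      = cover (int d) f k (int i) + int (d * n) - int i + 1"
    unfolding cover_def D using b D' by auto
  then show ?thesis unfolding M by (metis nat_int)
qed

lemma Lset_eq:
  assumes k: "k \<in> {1..n}" and d: "0 < d"
  shows "Lset n d p k = arc_modules n (d * n) (cover (int d) False (int k))"
proof -
  have "Lset n d p k = (\<lambda>i. Mmod n i (kk n p i) (if hat n p i \<inter> block p k = {} then 0 else d - 1)) ` {1..n}"
    unfolding Lset_def by blast
  also have "\<dots> = (\<lambda>i. (i, nat (cover (int d) False (int k) (int i) + int (d * n) - int i + 1))) ` {1..n}"
    by (intro image_cong HOL.refl) (simp only: hat_block_iff[OF _ k] Mmod_cover[OF _ d, symmetric] wrap_def simp_thms)
  finally show ?thesis by (simp add: arc_modules_def)
qed

lemma Sset_eq: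
  assumes k: "k \<in> {1..n}" and d: "0 < d"
  shows "Sset n d p k = arc_modules n (d * n) (cover (int d) True (int k))"
proof -
  have "Sset n d p k = (\<lambda>i. Mmod n i (kk n p i) (if hat n p i \<inter> block p k = {} \<or> i = k then 0 else d - 1)) ` {1..n}"
    unfolding Sset_def by blast
  also have "\<dots> = (\<lambda>i. (i, nat (cover (int d) True (int k) (int i) + int (d * n) - int i + 1))) ` {1..n}"
    by (intro image_cong HOL.refl)
      (simp only: hat_block_iff[OF _ k] eq_iff_dvd[OF n _ k] Mmod_cover[OF _ d, symmetric] wrap_def simp_thms)
  finally show ?thesis by (simp add: arc_modules_def)
qed

lemma join_noncrossing_iff:
  assumes k: "k \<in> {1..n}" and k': "k' \<in> {1..n}"
  shows "noncrossing n (join_part p k k') \<longleftrightarrow> noncrossing_rel (int n) (join_rel (int k) (int k'))"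
proof -
  let ?B = "block p k" and ?B' = "block p k'" and ?J = "join_part p k k'"
  note B = block_mem[OF n partition k] block_mem[OF n partition k']
  have part: "partition_on {1..n} ?J"
  proof (rule partition_onI)
    show "\<Union> ?J = {1..n}"
    proof
      show "\<Union> ?J \<subseteq> {1..n}" using B block_subset[OF n partition] unfolding join_part_def by blast
      show "{1..n} \<subseteq> \<Union> ?J" using ex_block[OF n partition] unfolding join_part_def by blast
    qed
    show "{} \<notin> ?J" using B partition by (auto simp: join_part_def partition_on_def)
    have *: "disjnt C D" if "C \<in> p" "D \<in> p" "C \<noteq> D" for C D
      using blocks_eq[OF n partition that(1,2)] that(3) by (auto simp: disjnt_def)
    have **: "disjnt (?B \<union> ?B') C" if "C \<in> p - {?B, ?B'}" for C
      using *[of ?B C] *[of ?B' C] B that by (auto simp: disjnt_Un1)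
    fix C D assume "C \<in> ?J" "D \<in> ?J" "C \<noteq> D"
    then show "disjnt C D" using * ** disjnt_sym unfolding join_part_def by blast
  qed
  have mem: "cyc n x \<in> ?B \<longleftrightarrow> part_rel n p x (int k)" "cyc n x \<in> ?B' \<longleftrightarrow> part_rel n p x (int k')" for x
    using part_rel_iff_block[OF n partition, of "int k" x] part_rel_iff_block[OF n partition, of "int k'" x]
      cyc_of_nat[OF k] cyc_of_nat[OF k'] sym by metis+
  have "part_rel n ?J x y \<longleftrightarrow> join_rel (int k) (int k') x y" for x y
  proof -
    have "part_rel n ?J x y \<longleftrightarrow> part_rel n p x y \<or> (cyc n x \<in> ?B \<union> ?B' \<and> cyc n y \<in> ?B \<union> ?B')"
      unfolding part_rel_def join_part_def bex_simps by auto
    then show ?thesis by (simp add: mem join_rel_def)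
  qed
  then have "part_rel n ?J = join_rel (int k) (int k')" by (simp add: fun_eq_iff)
  then show ?thesis using noncrossing_iff[OF n part] by simp
qed

lemma pred_system_part_cover:
  "0 < d \<Longrightarrow> pred_system (int n) (int (d * n)) (cover (int d) f k)"
  using pred_system_cover[of "int d" f k] by simp

end

theorem theorem4p10:
  fixes n d :: nat
  assumes n_pos: "0 < n" and d_pos: "0 < d"
    and alg_closed: "\<forall>q :: 'k::field poly. 0 < degree q \<longrightarrow> (\<exists>x. poly q x = 0)"
  shows "(\<forall>p k. noncrossing n p \<and> k \<in> {1..n} \<longrightarrow>
            sms TYPE('k) n (d * n) (Lset n d p k) \<and> sms TYPE('k) n (d * n) (Sset n d p k))
       \<and> (\<forall>S. sms TYPE('k) n (d * n) S \<longrightarrow>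
            (\<exists>p k. noncrossing n p \<and> k \<in> {1..n} \<and> (S = Lset n d p k \<or> S = Sset n d p k)))
       \<and> (2 \<le> d \<longrightarrow> (\<forall>p p' k k'. noncrossing n p \<and> noncrossing n p' \<and> k \<in> {1..n} \<and> k' \<in> {1..n} \<longrightarrow>
            Lset n d p k \<noteq> Sset n d p' k'
          \<and> (Lset n d p k = Lset n d p' k' \<longleftrightarrow> p = p' \<and> block p k = block p k')
          \<and> (Sset n d p k = Sset n d p' k' \<longleftrightarrow>
               p = p' \<and> (k = k' \<or> hat n p k \<inter> hat n p k' = {}) \<and> noncrossing n (join_part p k k'))))"
proof (intro conjI allI impI)
  fix p k assume a: "noncrossing n p \<and> k \<in> {1..n}"
  then have p: "noncrossing n p" and k: "k \<in> {1..n}" by auto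
  show "sms TYPE('k) n (d * n) (Lset n d p k)" "sms TYPE('k) n (d * n) (Sset n d p k)"
    unfolding Lset_eq[OF p n_pos k d_pos] Sset_eq[OF p n_pos k d_pos]
    by (rule sms_arc_modules[OF pred_system_part_cover[OF p n_pos d_pos]])+
next
  fix S assume "sms TYPE('k) n (d * n) S"
  then obtain F where F: "pred_system (int n) (int (d * n)) F" and S: "S = arc_modules n (d * n) F"
    by (rule sms_imp_pred_system) (use n_pos d_pos in auto)
  obtain R f k where R: "noncrossing_rel (int n) R" and FR: "F = noncrossing_rel.cover (int n) R (int d) f k"
    by (rule pred_system_is_cover[of "int n" "int d" F]) (use F d_pos in auto)
  obtain p where p: "noncrossing n p" "part_rel n p = R" using R by (rule ex_partition)
  interpret R: noncrossing_rel "int n" R by (rule R)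
  let ?k = "cyc n k"
  have k: "?k \<in> {1..n}" by (rule cyc_range[OF n_pos])
  \<comment> \<open>The classification yields an arbitrary integer \<open>k\<close>;
    \<open>wrap\<close> depends only on its residue, so its representative in \<open>{1..n}\<close>
    may be used.\<close>
  have "R.wrap f (int ?k) x = R.wrap f k x" for x
    using R.gap_rel[OF R.rel_dvd[OF cyc_dvd[OF n_pos, of k]], of x] cyc_dvd[OF n_pos, of k]
      dvd_add_left_iff[of "int n" "int ?k - k" "x - int ?k"] by (simp add: R.wrap_def)
  then have "F = R.cover (int d) f (int ?k)" by (intro ext) (simp add: FR R.cover_def)
  then have "S = Lset n d p ?k \<or> S = Sset n d p ?k"
    using Lset_eq[OF p(1) n_pos k d_pos] Sset_eq[OF p(1) n_pos k d_pos] S p(2) by (cases f) simp_all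
  then show "\<exists>p k. noncrossing n p \<and> k \<in> {1..n} \<and> (S = Lset n d p k \<or> S = Sset n d p k)"
    using p(1) k by blast
next
  fix p p' k k'
  assume d2: "2 \<le> d" and a: "noncrossing n p \<and> noncrossing n p' \<and> k \<in> {1..n} \<and> k' \<in> {1..n}"
  have p: "noncrossing n p" and p': "noncrossing n p'" and k: "k \<in> {1..n}" and k': "k' \<in> {1..n}" using a by auto
  note part = partition[OF p n_pos] partition[OF p' n_pos]
  interpret R: noncrossing_rel "int n" "part_rel n p" using noncrossing_iff[OF n_pos part(1)] p by simp
  interpret R': noncrossing_rel "int n" "part_rel n p'" using noncrossing_iff[OF n_pos part(2)] p' by simp
  have "arc_modules n (d * n) (R.cover (int d) f (int k)) = arc_modules n (d * n) (R'.cover (int d) f' (int k')) \<longleftrightarrow>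
      p = p' \<and> R.wrap f (int k) = R.wrap f' (int k')" for f f'
    unfolding arc_modules_eq_iff[OF pred_system_part_cover[OF p n_pos d_pos] pred_system_part_cover[OF p' n_pos d_pos]]
    using cover_eq_iff[OF R.noncrossing_rel_axioms R'.noncrossing_rel_axioms, of "int d" f "int k" f' "int k'"] d2
      part_rel_inj[OF n_pos part] by auto
  note eq = this
  note sets = Lset_eq[OF p n_pos k d_pos] Lset_eq[OF p' n_pos k' d_pos]
    Sset_eq[OF p n_pos k d_pos] Sset_eq[OF p' n_pos k' d_pos]
  show "Lset n d p k \<noteq> Sset n d p' k'"
    unfolding sets eq using R.wrap_False_neq_True by blast
  show "Lset n d p k = Lset n d p' k' \<longleftrightarrow> p = p' \<and> block p k = block p k'"
    unfolding sets eq R.wrap_False_eq_iff block_eq_iff[OF n_pos part(1) k k'] ..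
  show "Sset n d p k = Sset n d p' k' \<longleftrightarrow>
      p = p' \<and> (k = k' \<or> hat n p k \<inter> hat n p k' = {}) \<and> noncrossing n (join_part p k k')"
    unfolding sets eq R.wrap_True_eq_iff hat_disjoint_iff[OF p n_pos k k'] join_noncrossing_iff[OF p n_pos k k']
      eq_iff_dvd[OF n_pos k k'] ..
qed

end
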